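(* For any integers $d\ge 1$ and $n\ge 2$, there exists a planar tropical curve of degree $d$ in $\mathbb{R}^n$ whose genus equals \[ (n-1)\cdot \frac{(d-1)\cdot (d-2)}{2}. \]
   Context: A tropical curve $C$ in $\mathbb{R}^n$ is a piecewise linear graph with finitely many vertices, each edge $e$ carrying a positive integer weight $w_e$ and having a direction in $\mathbb{Z}^n$, such that at each vertex $v$ with adjacent edges $e_1,\dots,e_l$ the balancing condition $\sum_i w_{e_i}u_{e_i}=0$ holds, where $u_{e_i}$ is the primitive integer direction of $e_i$ pointing away from $v$. The degree of $C$ is $\sum_e w_e\max_{j=1,\dots,n}\{0,u_{e,j}\}$, the sum being over unbounded edges $e$, with $u_e=(u_{e,1},\dots,u_{e,n})$ the primitive integer direction of $e$ pointing to infinity. The genus of a tropical curve is its first Betti number. A tropical plane is a tropical linear space of dimension $2$ (in the standard sense, i.e. a matroidal tropical linear space, equivalently a tropical variety of dimension $2$ and degree $1$); a tropical curve in $\mathbb{R}^n$ is called planar if it is contained in a tropical plane in $\mathbb{R}^n$. *)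

theory Defs
  imports "HOL-Analysis.Analysis"
begin

section \<open>Integer directions\<close>

text \<open>An integer vector is primitive if it is nonzero and its entries have no
common divisor other than 1 and -1.\<close>
definition primitive :: "int^'n::finite \<Rightarrow> bool" where
  "primitive u \<longleftrightarrow> u \<noteq> 0 \<and> (\<forall>k::int. (\<forall>i. k dvd u $ i) \<longrightarrow> \<bar>k\<bar> = 1)"

definition ivec :: "int^'n::finite \<Rightarrow> real^'n" where
  "ivec u = (\<chi> i. real_of_int (u $ i))"

section \<open>Tropical curves as embedded weighted graphs\<close>

text \<open>Vertices and edges are labelled by natural numbers. Bounded edge e runs from
fst (ends e) to snd (ends e) with primitive direction bdir e (pointing from the first
to the second endpoint) and weight bwt e. Unbounded edge e is the ray starting at
the vertex ubase e in primitive direction udir e with weight uwt e.\<close>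
record ('n::finite) tcurve =
  verts :: "nat set"
  pos :: "nat \<Rightarrow> real^'n"
  bedges :: "nat set"
  ends :: "nat \<Rightarrow> nat \<times> nat"
  bdir :: "nat \<Rightarrow> int^'n"
  bwt :: "nat \<Rightarrow> nat"
  uedges :: "nat set"
  ubase :: "nat \<Rightarrow> nat"
  udir :: "nat \<Rightarrow> int^'n"
  uwt :: "nat \<Rightarrow> nat"

text \<open>Relative interior of a bounded edge and of an unbounded edge.\<close>
definition bint :: "('n::finite) tcurve \<Rightarrow> nat \<Rightarrow> (real^'n) set" where
  "bint C e = open_segment (pos C (fst (ends C e))) (pos C (snd (ends C e)))"

definition rint :: "('n::finite) tcurve \<Rightarrow> nat \<Rightarrow> (real^'n) set" where
  "rint C e = {pos C (ubase C e) + t *\<^sub>R ivec (udir C e) | t. t > 0}"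

text \<open>The underlying point set of the curve.\<close>
definition support :: "('n::finite) tcurve \<Rightarrow> (real^'n) set" where
  "support C = pos C ` verts C \<union> (\<Union>e\<in>bedges C. bint C e) \<union> (\<Union>e\<in>uedges C. rint C e)"

definition tropical_curve :: "('n::finite) tcurve \<Rightarrow> bool" where
  "tropical_curve C \<longleftrightarrow>
     finite (verts C) \<and> finite (bedges C) \<and> finite (uedges C) \<and>
     (\<forall>e\<in>bedges C. fst (ends C e) \<in> verts C \<and> snd (ends C e) \<in> verts C \<and>
        bwt C e > 0 \<and> primitive (bdir C e) \<and>
        (\<exists>t>0. pos C (snd (ends C e)) - pos C (fst (ends C e)) = t *\<^sub>R ivec (bdir C e))) \<and>
     (\<forall>e\<in>uedges C. ubase C e \<in> verts C \<and> uwt C e > 0 \<and> primitive (udir C e)) \<and>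
     \<comment> \<open>balancing condition at every vertex\<close>
     (\<forall>v\<in>verts C. \<forall>i.
        (\<Sum>e\<in>{e\<in>bedges C. fst (ends C e) = v}. int (bwt C e) * bdir C e $ i)
      - (\<Sum>e\<in>{e\<in>bedges C. snd (ends C e) = v}. int (bwt C e) * bdir C e $ i)
      + (\<Sum>e\<in>{e\<in>uedges C. ubase C e = v}. int (uwt C e) * udir C e $ i) = 0) \<and>
     \<comment> \<open>the graph is embedded in R^n (a piecewise linear graph in R^n)\<close>
     inj_on (pos C) (verts C) \<and>
     (\<forall>e\<in>bedges C. bint C e \<inter> pos C ` verts C = {}) \<and>
     (\<forall>e\<in>uedges C. rint C e \<inter> pos C ` verts C = {}) \<and>
     (\<forall>e\<in>bedges C. \<forall>e'\<in>bedges C. e \<noteq> e' \<longrightarrow> bint C e \<inter> bint C e' = {}) \<and>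
     (\<forall>e\<in>uedges C. \<forall>e'\<in>uedges C. e \<noteq> e' \<longrightarrow> rint C e \<inter> rint C e' = {}) \<and>
     (\<forall>e\<in>bedges C. \<forall>e'\<in>uedges C. bint C e \<inter> rint C e' = {})"

text \<open>Degree: sum over unbounded edges of w_e * max(0, u_1, ..., u_n).\<close>
definition degree :: "('n::finite) tcurve \<Rightarrow> int" where
  "degree C = (\<Sum>e\<in>uedges C. int (uwt C e) * Max (insert 0 (range (\<lambda>i. udir C e $ i))))"

text \<open>Genus: first Betti number of the graph = #bounded edges - #vertices + #components
(unbounded edges are contractible rays and do not contribute).\<close>
definition adj :: "('n::finite) tcurve \<Rightarrow> (nat \<times> nat) set" where
  "adj C = {(a, b). \<exists>e\<in>bedges C. ends C e = (a, b) \<or> ends C e = (b, a)}"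

definition genus :: "('n::finite) tcurve \<Rightarrow> int" where
  "genus C = int (card (bedges C)) - int (card (verts C)) + int (card (verts C // (adj C)\<^sup>*))"

section \<open>Tropical linear spaces (max convention)\<close>

text \<open>Valuated matroid of rank r on the finite ground set UNIV :: 'a set, in max
convention: Bs is the set of bases (where the valuation is finite) and p the valuation.\<close>
definition valuated_matroid :: "nat \<Rightarrow> ('a::finite) set set \<Rightarrow> ('a set \<Rightarrow> real) \<Rightarrow> bool" where
  "valuated_matroid r Bs p \<longleftrightarrow> Bs \<noteq> {} \<and> (\<forall>B\<in>Bs. card B = r) \<and>
     (\<forall>B\<in>Bs. \<forall>B'\<in>Bs. \<forall>i\<in>B - B'. \<exists>j\<in>B' - B.
        B - {i} \<union> {j} \<in> Bs \<and> B' - {j} \<union> {i} \<in> Bs \<and>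
        p B + p B' \<le> p (B - {i} \<union> {j}) + p (B' - {j} \<union> {i}))"

text \<open>Points of R^n are identified with R^{0..n} / R(1,...,1) via x_0 = 0; the extra
coordinate is None.\<close>
definition hcoord :: "real^'n::finite \<Rightarrow> 'n option \<Rightarrow> real" where
  "hcoord x k = (case k of None \<Rightarrow> 0 | Some i \<Rightarrow> x $ i)"

text \<open>Tropical linear space of a rank r valuated matroid: for every (r+1)-subset tau,
the maximum of p(tau - i) + x_i over i in tau (terms with tau - i not a basis are -infinity)
is attained at least twice.\<close>
definition trop_linear_space ::
  "nat \<Rightarrow> ('n::finite) option set set \<Rightarrow> ('n option set \<Rightarrow> real) \<Rightarrow> (real^'n) set" where
  "trop_linear_space r Bs p = {x. \<forall>\<tau>. card \<tau> = Suc r \<longrightarrow>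
     (\<forall>i\<in>\<tau>. \<tau> - {i} \<in> Bs \<longrightarrow>
        (\<exists>j\<in>\<tau>. j \<noteq> i \<and> \<tau> - {j} \<in> Bs \<and>
           p (\<tau> - {i}) + hcoord x i \<le> p (\<tau> - {j}) + hcoord x j))}"

text \<open>A tropical plane in R^n: tropical linear space of a rank 3 valuated matroid on n+1 elements.\<close>
definition tropical_plane :: "(real^'n::finite) set \<Rightarrow> bool" where
  "tropical_plane P \<longleftrightarrow> (\<exists>Bs p. valuated_matroid 3 Bs p \<and> P = trop_linear_space 3 Bs p)"

definition planar :: "('n::finite) tcurve \<Rightarrow> bool" where
  "planar C \<longleftrightarrow> (\<exists>P. tropical_plane P \<and> support C \<subseteq> P)"

end

theory Submission
  imports Defs "HOL-Library.Countable"
begin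

text \<open>
Order the \<open>n + 1\<close> homogeneous coordinates as \<open>0, \<dots>, n\<close>. The function \<open>max B - min B\<close> on triples is a
valuated matroid, and its tropical plane contains the caterpillar tropical line whose \<open>n - 1\<close> vertices
are the points \<open>v\<^sub>k = (\<bar>i - k\<bar>)\<^sub>i\<close>; moreover, near \<open>v\<^sub>k\<close> it contains a neighbourhood of \<open>v\<^sub>k\<close> in the
whole 2-plane spanned by the three edges of the line at \<open>v\<^sub>k\<close>. Give every edge of the line weight \<open>d\<close>
and replace each vertex by a small curve in that 2-plane, dual to a subdivision of the triangle of size
\<open>d\<close> which uses every interior lattice point but leaves two of its sides undivided, so that the two rays
along which consecutive pieces are glued have weight \<open>d\<close>. Each of the \<open>n - 1\<close> pieces contributes
\<open>(d - 1) (d - 2) / 2\<close> cycles and the total degree remains \<open>d\<close>.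
\<close>

section \<open>A tropical plane\<close>

text \<open>The value max B - min B is half the sum of the three pairwise distances in B; on pairs
  the distance itself is the valuation of the caterpillar line. The 2-planes at two consecutive
  vertices of that line meet only in the straight line through their common edge, so a curve can
  pass from one chart to the next only along this edge. This forces all strands of a piece to merge
  into one edge of weight \<open>d\<close>, and leaving two sides of the dual triangle undivided
  achieves it. No cycle is lost, because the cycles of a piece correspond to the interior lattice
  points of the triangle, and all of these remain vertices of the subdivision. The laborious
  condition is embeddedness. Inside one piece every cell carries the exact set of terms that are
  maximal on it: meeting cells have equal labels, and a label determines its cell. Across pieces, a
  projection to each chart reduces the question to a single piece. Each piece is shrunk by a factor
  \<epsilon> so that it fits into the part of the plane that its chart describes.\<close>

definition spread :: "('a \<Rightarrow> real) \<Rightarrow> 'a set \<Rightarrow> real" where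
  "spread f B = Max (f ` B) - Min (f ` B)"

lemma spread_triple:
  "spread f {a, b, c} = max (f a) (max (f b) (f c)) - min (f a) (min (f b) (f c))"
  by (simp add: spread_def)

text \<open>For each ordering of the six values the claim is a set of linear inequalities. Which of
  the three exchanges succeeds depends on the ordering, hence the disjunction.\<close>

lemma spread_exchange_disjoint:
  fixes i b c x y z :: real
  defines "s \<equiv> \<lambda>u v w. max u (max v w) - min u (min v w)"
  shows "s i b c + s x y z \<le> s x b c + s i y z \<or>
         s i b c + s x y z \<le> s y b c + s x i z \<or>
         s i b c + s x y z \<le> s z b c + s x y i"
  unfolding s_def max_def min_def by (smt (verit))

lemma spread_exchange_common:
  fixes i b c x y :: real
  defines "s \<equiv> \<lambda>u v w. max u (max v w) - min u (min v w)"
  shows "s i b c + s x y c \<le> s x b c + s i y c \<or>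
         s i b c + s x y c \<le> s y b c + s x i c"
  unfolding s_def max_def min_def by (smt (verit))

lemma valuated_matroid_spread:
  fixes f :: "'a::finite \<Rightarrow> real"
  assumes "CARD('a) \<ge> 3"
  shows "valuated_matroid 3 {B. card B = 3} (spread f)"
  unfolding valuated_matroid_def
proof (intro conjI ballI)
  show "{B::'a set. card B = 3} \<noteq> {}"
    using obtain_subset_with_card_n[OF assms] by auto
next
  fix B :: "'a set" assume "B \<in> {B. card B = 3}" then show "card B = 3" by simp
next
  fix B B' :: "'a set" and i
  assume B: "B \<in> {B. card B = 3}" and B': "B' \<in> {B. card B = 3}" and i: "i \<in> B - B'"
  have "card (B - {i}) = 2" using B i by simp
  then obtain b c where bc: "B - {i} = {b, c}" "b \<noteq> c"
    by (auto simp: card_2_iff)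
  then have Bi: "B = {i, b, c}" "i \<noteq> b" "i \<noteq> c" using i by auto
  have key: "\<exists>j\<in>B' - B. spread f B + spread f B' \<le> spread f (B - {i} \<union> {j}) + spread f (B' - {j} \<union> {i})"
  proof (cases "b \<in> B' \<or> c \<in> B'")
    case False
    obtain x y z where xyz: "B' = {x, y, z}" "x \<noteq> y" "x \<noteq> z" "y \<noteq> z"
      using B' by (auto simp: card_3_iff)
    have out: "x \<in> B' - B" "y \<in> B' - B" "z \<in> B' - B" using False i Bi xyz by auto
    have s: "B' - {x} \<union> {i} = {i, y, z}" "B' - {y} \<union> {i} = {x, i, z}" "B' - {z} \<union> {i} = {x, y, i}"
      using xyz by auto
    have t: "B - {i} \<union> {j} = {j, b, c}" for j using bc by auto
    have "\<exists>j\<in>{x, y, z}. spread f B + spread f B'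
        \<le> spread f (B - {i} \<union> {j}) + spread f (B' - {j} \<union> {i})"
      using spread_exchange_disjoint[of "f i" "f b" "f c" "f x" "f y" "f z"]
      unfolding bex_simps(5) t s unfolding Bi(1) xyz(1) spread_triple by simp
    then show ?thesis
      using out by blast
  next
    case True
    \<comment> \<open>Rename the two elements other than \<open>i\<close> so that the second one is
      common to both bases.\<close>
    then obtain b' c' where bc': "{b, c} = {b', c'}" "c' \<in> B'" "b' \<noteq> c'"
      using bc by blast
    have Bi': "B = {i, b', c'}" "i \<noteq> b'" "i \<noteq> c'" using Bi bc' by auto
    have "card (B' - {c'}) = 2" using B' bc' by simp
    then obtain x y where xy: "B' - {c'} = {x, y}" "x \<noteq> y" by (auto simp: card_2_iff)
    then have B'e: "B' = {x, y, c'}" "x \<noteq> c'" "y \<noteq> c'" using bc' by auto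
    have t: "B - {i} \<union> {j} = {j, b', c'}" for j using bc bc' by auto
    have s: "B' - {x} \<union> {i} = {i, y, c'}" "B' - {y} \<union> {i} = {x, i, c'}"
      using B'e xy by auto
    show ?thesis
    proof (cases "b' \<in> B'")
      case True
      \<comment> \<open>With two common elements the only exchange swaps the two bases, and equality
        holds.\<close>
      then obtain j where j: "B' = {j, b', c'}" "j \<noteq> b'" "j \<noteq> c'"
        using B'e bc' xy by auto
      then have "j \<in> B' - B" using i Bi' by auto
      moreover have "B - {i} \<union> {j} = B'" using t j by simp
      moreover have "B' - {j} \<union> {i} = B" using j Bi' by auto
      ultimately show ?thesis by (metis add.commute order_refl)
    next
      case False
      have out: "x \<in> B' - B" "y \<in> B' - B" using False i Bi' B'e by auto
      have "\<exists>j\<in>{x, y}. spread f B + spread f B'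
        \<le> spread f (B - {i} \<union> {j}) + spread f (B' - {j} \<union> {i})"
        using spread_exchange_common[of "f i" "f b'" "f c'" "f x" "f y"]
        unfolding bex_simps(5) t s unfolding Bi'(1) B'e(1) spread_triple by simp
      then show ?thesis
        using out by blast
    qed
  qed
  then obtain j where j: "j \<in> B' - B"
    "spread f B + spread f B' \<le> spread f (B - {i} \<union> {j}) + spread f (B' - {j} \<union> {i})" by blast
  have "card (B - {i} \<union> {j}) = 3" "card (B' - {j} \<union> {i}) = 3"
    using B B' i j(1) by (auto simp: card_insert_if)
  with j show "\<exists>j\<in>B' - B. B - {i} \<union> {j} \<in> {B. card B = 3} \<and> B' - {j} \<union> {i} \<in> {B. card B = 3} \<and>
     spread f B + spread f B' \<le> spread f (B - {i} \<union> {j}) + spread f (B' - {j} \<union> {i})" by blast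
qed

section \<open>The ordered coordinates and the plane of the valuation\<close>

locale ground_order =
  fixes idx :: "'n::finite \<Rightarrow> nat" and n :: nat
  assumes idx_bij: "bij_betw idx UNIV {1..n}"
begin

definition idx0 :: "'n option \<Rightarrow> nat" where
  "idx0 = case_option 0 idx"

lemma idx0_simps [simp]: "idx0 None = 0" "idx0 (Some i) = idx i"
  by (simp_all add: idx0_def)

lemma idx_bounds: "1 \<le> idx i" "idx i \<le> n"
  using bij_betw_apply[OF idx_bij, of i] by auto

lemma idx0_le: "idx0 i \<le> n"
  by (cases i) (auto simp: idx_bounds)

lemma inj_idx0: "inj idx0"
proof (rule injI)
  fix x y assume "idx0 x = idx0 y"
  moreover have "idx i \<noteq> 0" for i using idx_bounds(1)[of i] by simp
  moreover have "inj idx" using idx_bij by (simp add: bij_betw_def)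
  ultimately show "x = y" by (cases x; cases y) (auto dest: injD)
qed

lemma card_n: "CARD('n) = n"
  using bij_betw_same_card[OF idx_bij] by simp

lemma four_sorted:
  assumes "card (\<tau> :: 'n option set) = 4"
  obtains a b c e where "\<tau> = {a, b, c, e}" "idx0 a < idx0 b" "idx0 b < idx0 c" "idx0 c < idx0 e"
proof -
  define s where "s = sorted_list_of_set (idx0 ` \<tau>)"
  have "card (idx0 ` \<tau>) = 4"
    using assms card_image[OF inj_on_subset[OF inj_idx0 subset_UNIV]] by metis
  then have "length s = 4" and set_s: "set s = idx0 ` \<tau>" and "sorted_wrt (<) s"
    by (simp_all add: s_def)
  then obtain p q r t where s: "s = [p, q, r, t]" and lt: "p < q" "q < r" "r < t"
    by (auto simp: numeral_eq_Suc length_Suc_conv)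
  have im: "idx0 ` \<tau> = {p, q, r, t}" using set_s s by simp
  have "p \<in> idx0 ` \<tau>" "q \<in> idx0 ` \<tau>" "r \<in> idx0 ` \<tau>" "t \<in> idx0 ` \<tau>"
    unfolding im by simp_all
  then obtain a b c e where abce: "a \<in> \<tau>" "b \<in> \<tau>" "c \<in> \<tau>" "e \<in> \<tau>"
      "p = idx0 a" "q = idx0 b" "r = idx0 c" "t = idx0 e"
    by blast
  have "idx0 ` \<tau> = idx0 ` {a, b, c, e}" using im abce by simp
  then have "\<tau> = {a, b, c, e}" by (rule iffD1[OF inj_image_eq_iff[OF inj_idx0]])
  with abce lt show ?thesis using that by blast
qed

definition plane :: "(real^'n) set" where
  "plane = trop_linear_space 3 {B. card B = 3} (spread (\<lambda>i. real (idx0 i)))"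

lemma tropical_plane_plane:
  assumes "n \<ge> 2"
  shows "tropical_plane plane"
proof -
  have "CARD('n option) \<ge> 3" using assms card_n by simp
  then show ?thesis
    unfolding tropical_plane_def plane_def using valuated_matroid_spread by blast
qed

text \<open>\<open>A\<close>, \<open>B\<close>, \<open>C\<close>, \<open>E\<close> are the four
  competing terms minus the common summand \<open>idx0 e - idx0 a\<close>; the spread does not see a
  middle element, so two of the corrections vanish. Of the six pairs that could share the maximum,
  only the lower two and the upper two indices are offered: points of the charts need no
  other.\<close>

lemma plane_memI:
  assumes "\<And>a b c e. idx0 a < idx0 b \<Longrightarrow> idx0 b < idx0 c \<Longrightarrow> idx0 c < idx0 e \<Longrightarrow>
      (let A = hcoord x a - (real (idx0 b) - real (idx0 a)); B = hcoord x b; C = hcoord x c;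
           E = hcoord x e - (real (idx0 e) - real (idx0 c))
       in C = E \<and> A \<le> C \<and> B \<le> C \<or> A = B \<and> C \<le> A \<and> E \<le> A)"
  shows "x \<in> plane"
  unfolding plane_def trop_linear_space_def mem_Collect_eq
proof (intro allI impI ballI)
  fix \<tau> :: "'n option set" and i
  assume \<tau>: "card \<tau> = Suc 3" and i: "i \<in> \<tau>"
  obtain a b c e where abce: "\<tau> = {a, b, c, e}" and lt: "idx0 a < idx0 b" "idx0 b < idx0 c" "idx0 c < idx0 e"
    by (rule four_sorted[of \<tau>]) (use \<tau> in simp)
  have ne: "a \<noteq> b" "a \<noteq> c" "a \<noteq> e" "b \<noteq> c" "b \<noteq> e" "c \<noteq> e" using lt by auto
  have rm: "\<tau> - {a} = {b, c, e}" "\<tau> - {b} = {a, c, e}" "\<tau> - {c} = {a, b, e}" "\<tau> - {e} = {a, b, c}"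
    using ne by (auto simp: abce)
  have card3: "card (\<tau> - {j}) = 3" if "j \<in> \<tau>" for j using \<tau> that by simp
  define w where "w = (\<lambda>j. spread (\<lambda>i. real (idx0 i)) (\<tau> - {j}) + hcoord x j)"
  have w: "w a = real (idx0 e) - real (idx0 b) + hcoord x a"
    "w b = real (idx0 e) - real (idx0 a) + hcoord x b"
    "w c = real (idx0 e) - real (idx0 a) + hcoord x c"
    "w e = real (idx0 c) - real (idx0 a) + hcoord x e"
    using lt by (simp_all add: w_def rm spread_triple max_def min_def)
  have "w c = w e \<and> w a \<le> w c \<and> w b \<le> w c \<or> w a = w b \<and> w c \<le> w a \<and> w e \<le> w a"
    using assms[OF lt] unfolding w Let_def by linarith
  then have "\<exists>j\<in>\<tau>. j \<noteq> i \<and> w i \<le> w j"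
    using i ne unfolding abce by auto
  then show "\<exists>j\<in>\<tau>. j \<noteq> i \<and> card (\<tau> - {j}) = 3 \<and>
      spread (\<lambda>i. real (idx0 i)) (\<tau> - {i}) + hcoord x i
        \<le> spread (\<lambda>i. real (idx0 i)) (\<tau> - {j}) + hcoord x j"
    using card3 i unfolding w_def by blast
qed

text \<open>\<open>base k\<close> is the vertex \<open>(\<bar>i - k\<bar>)\<^sub>i\<close> of the tropical line, translated so that its coordinate 0 vanishes.\<close>

definition base :: "nat \<Rightarrow> nat \<Rightarrow> real" where
  "base k m = (if m \<le> k then - real m else real m - 2 * real k)"

text \<open>Two indices below \<open>k\<close> always give \<open>A = B\<close>, two indices above
  \<open>k\<close> always give \<open>C = E\<close>. If both happen, the larger pair wins without
  any bound; the bounds matter when one of the lower or upper two indices lies on the wrong side or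
  equals \<open>k\<close>. Such index sets need three indices at most \<open>k\<close>, or two
  indices above \<open>k\<close>, so at an end of the line the chart is unbounded towards that
  end.\<close>

lemma plane_chart:
  assumes k: "1 \<le> k" "k < n"
    and x: "\<And>i. hcoord x i = base k (idx0 i) + (if idx0 i < k then 0 else if idx0 i = k then g else b)"
    and right: "k < n - 1 \<Longrightarrow> -1 \<le> b \<and> g \<le> 1 + b"
    and left: "1 < k \<Longrightarrow> g \<le> 1 \<and> b \<le> 1"
  shows "x \<in> plane"
proof (rule plane_memI)
  fix p q r s
  assume lt: "idx0 p < idx0 q" "idx0 q < idx0 r" "idx0 r < idx0 s"
  have s: "idx0 s \<le> n" by (rule idx0_le)
  show "let A = hcoord x p - (real (idx0 q) - real (idx0 p)); B = hcoord x q; C = hcoord x r;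
           E = hcoord x s - (real (idx0 s) - real (idx0 r))
       in C = E \<and> A \<le> C \<and> B \<le> C \<or> A = B \<and> C \<le> A \<and> E \<le> A"
  proof (cases "idx0 r \<le> k")
    case True
    then have "1 < k" using lt by linarith
    with left have "g \<le> 1" "b \<le> 1" by auto
    with True lt show ?thesis
      unfolding x Let_def base_def by (auto split: if_splits)
  next
    case False
    then have "k < n - 1" using lt s by linarith
    with right have "-1 \<le> b" "g \<le> 1 + b" by auto
    with False lt show ?thesis
      unfolding x Let_def base_def by (auto split: if_splits)
  qed
qed

end

section \<open>Curves with labels of arbitrary countable type\<close>

lemma sum_to_nat:
  fixes A :: "'a::countable set"
  shows "(\<Sum>e\<in>{e \<in> to_nat ` A. P (from_nat e :: 'a)}. g (from_nat e :: 'a)) = (\<Sum>e\<in>{e\<in>A. P e}. g e)"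
proof -
  have "{e \<in> to_nat ` A. P (from_nat e :: 'a)} = to_nat ` {e\<in>A. P e}" by auto
  then show ?thesis
    by (simp add: sum.reindex[OF inj_on_subset[OF inj_to_nat subset_UNIV]])
qed

lemma quotient_rtrancl_connected:
  assumes v0: "v0 \<in> V" and r: "r \<subseteq> V \<times> V" and sym: "sym r"
    and conn: "\<And>v. v \<in> V \<Longrightarrow> (v0, v) \<in> r\<^sup>*"
  shows "V // r\<^sup>* = {V}"
proof -
  have "r\<^sup>* `` {v} = V" if "v \<in> V" for v
  proof (intro set_eqI iffI)
    fix w assume "w \<in> r\<^sup>* `` {v}"
    then have "(v, w) \<in> r\<^sup>*" by simp
    then show "w \<in> V" using \<open>v \<in> V\<close> r by (induction) auto
  next
    fix w assume "w \<in> V"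
    have "(v, v0) \<in> r\<^sup>*" using conn[OF that] sym_rtrancl[OF sym] by (auto dest: symD)
    with conn[OF \<open>w \<in> V\<close>] show "w \<in> r\<^sup>* `` {v}" by (auto intro: rtrancl_trans)
  qed
  then show ?thesis using v0 by (auto simp: quotient_def)
qed

text \<open>Allows vertices and edges to be indexed by pairs and sums, which \<open>to_nat\<close>
  then turns into the labels of a \<open>tcurve\<close>. Reachability from \<open>v0\<close> leaves
  a single component, whence the summand 1 in the genus.\<close>

lemma relabelled_curve:
  fixes V :: "'v::countable set" and E :: "'e::countable set" and F :: "'f::countable set"
    and P :: "'v \<Rightarrow> real^'n::finite" and D :: "'e \<Rightarrow> int^'n" and R :: "'f \<Rightarrow> int^'n"
  assumes fin: "finite V" "finite E" "finite F"
    and E: "\<And>e. e \<in> E \<Longrightarrow> src e \<in> V \<and> tgt e \<in> V \<and> w e > 0 \<and> primitive (D e) \<and>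
       (\<exists>t>0. P (tgt e) - P (src e) = t *\<^sub>R ivec (D e))"
    and F: "\<And>f. f \<in> F \<Longrightarrow> b f \<in> V \<and> wF f > 0 \<and> primitive (R f)"
    and bal: "\<And>v i. v \<in> V \<Longrightarrow> (\<Sum>e\<in>{e\<in>E. src e = v}. int (w e) * D e $ i)
       - (\<Sum>e\<in>{e\<in>E. tgt e = v}. int (w e) * D e $ i)
       + (\<Sum>f\<in>{f\<in>F. b f = v}. int (wF f) * R f $ i) = 0"
    and inj: "inj_on P V"
    and EV: "\<And>e. e \<in> E \<Longrightarrow> open_segment (P (src e)) (P (tgt e)) \<inter> P ` V = {}"
    and FV: "\<And>f. f \<in> F \<Longrightarrow> {P (b f) + t *\<^sub>R ivec (R f) | t. t > 0} \<inter> P ` V = {}"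
    and EE: "\<And>e e'. e \<in> E \<Longrightarrow> e' \<in> E \<Longrightarrow> e \<noteq> e' \<Longrightarrow>
       open_segment (P (src e)) (P (tgt e)) \<inter> open_segment (P (src e')) (P (tgt e')) = {}"
    and FF: "\<And>f f'. f \<in> F \<Longrightarrow> f' \<in> F \<Longrightarrow> f \<noteq> f' \<Longrightarrow>
       {P (b f) + t *\<^sub>R ivec (R f) | t. t > 0} \<inter> {P (b f') + t *\<^sub>R ivec (R f') | t. t > 0} = {}"
    and EF: "\<And>e f. e \<in> E \<Longrightarrow> f \<in> F \<Longrightarrow>
       open_segment (P (src e)) (P (tgt e)) \<inter> {P (b f) + t *\<^sub>R ivec (R f) | t. t > 0} = {}"
    and root: "v0 \<in> V"
    and conn: "\<And>v. v \<in> V \<Longrightarrow> (v0, v) \<in> {(x, y). \<exists>e\<in>E. (src e, tgt e) = (x, y) \<or> (src e, tgt e) = (y, x)}\<^sup>*"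
  shows "\<exists>C :: 'n tcurve. tropical_curve C \<and>
     support C = P ` V \<union> (\<Union>e\<in>E. open_segment (P (src e)) (P (tgt e)))
       \<union> (\<Union>f\<in>F. {P (b f) + t *\<^sub>R ivec (R f) | t. t > 0}) \<and>
     degree C = (\<Sum>f\<in>F. int (wF f) * Max (insert 0 (range (\<lambda>i. R f $ i)))) \<and>
     genus C = int (card E) - int (card V) + 1"
proof -
  define C :: "'n tcurve" where "C = \<lparr>
    verts = to_nat ` V, pos = P \<circ> from_nat,
    bedges = to_nat ` E, ends = (\<lambda>e. (to_nat (src (from_nat e)), to_nat (tgt (from_nat e)))),
    bdir = D \<circ> from_nat, bwt = w \<circ> from_nat,
    uedges = to_nat ` F, ubase = (\<lambda>f. to_nat (b (from_nat f))), udir = R \<circ> from_nat, uwt = wF \<circ> from_nat\<rparr>"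
  have sel: "verts C = to_nat ` V" "pos C = P \<circ> from_nat" "bedges C = to_nat ` E"
    "ends C = (\<lambda>e. (to_nat (src (from_nat e)), to_nat (tgt (from_nat e))))"
    "bdir C = D \<circ> from_nat" "bwt C = w \<circ> from_nat" "uedges C = to_nat ` F"
    "ubase C = (\<lambda>f. to_nat (b (from_nat f)))" "udir C = R \<circ> from_nat" "uwt C = wF \<circ> from_nat"
    by (simp_all add: C_def)
  have posV: "pos C ` verts C = P ` V" by (force simp: sel)
  have bint: "bint C (to_nat e) = open_segment (P (src e)) (P (tgt e))" for e
    by (simp add: bint_def sel)
  have rint: "rint C (to_nat f) = {P (b f) + t *\<^sub>R ivec (R f) | t. t > 0}" for f
    by (simp add: rint_def sel)
  have "tropical_curve C"
    unfolding tropical_curve_def posV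
  proof (intro conjI)
    show "finite (verts C)" "finite (bedges C)" "finite (uedges C)" using fin by (simp_all add: sel)
    show "\<forall>e\<in>bedges C. fst (ends C e) \<in> verts C \<and> snd (ends C e) \<in> verts C \<and>
        bwt C e > 0 \<and> primitive (bdir C e) \<and>
        (\<exists>t>0. pos C (snd (ends C e)) - pos C (fst (ends C e)) = t *\<^sub>R ivec (bdir C e))"
      using E by (auto simp: sel)
    show "\<forall>e\<in>uedges C. ubase C e \<in> verts C \<and> uwt C e > 0 \<and> primitive (udir C e)"
      using F by (auto simp: sel)
    show "inj_on (pos C) (verts C)" using inj by (auto simp: sel inj_on_def)
    show "\<forall>e\<in>bedges C. bint C e \<inter> P ` V = {}" using EV by (auto simp: sel(3) bint)
    show "\<forall>e\<in>uedges C. rint C e \<inter> P ` V = {}" using FV by (simp add: sel(7) rint)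
    show "\<forall>e\<in>bedges C. \<forall>e'\<in>bedges C. e \<noteq> e' \<longrightarrow> bint C e \<inter> bint C e' = {}"
      using EE by (auto simp: sel(3) bint)
    show "\<forall>e\<in>uedges C. \<forall>e'\<in>uedges C. e \<noteq> e' \<longrightarrow> rint C e \<inter> rint C e' = {}"
      using FF by (simp add: sel(7) rint)
    show "\<forall>e\<in>bedges C. \<forall>e'\<in>uedges C. bint C e \<inter> rint C e' = {}"
      using EF by (simp add: sel(3,7) bint rint)
    show "\<forall>v\<in>verts C. \<forall>i.
        (\<Sum>e\<in>{e\<in>bedges C. fst (ends C e) = v}. int (bwt C e) * bdir C e $ i)
      - (\<Sum>e\<in>{e\<in>bedges C. snd (ends C e) = v}. int (bwt C e) * bdir C e $ i)
      + (\<Sum>e\<in>{e\<in>uedges C. ubase C e = v}. int (uwt C e) * udir C e $ i) = 0"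
    proof (intro ballI allI)
      fix v i assume "v \<in> verts C"
      then obtain v' where v': "v' \<in> V" "v = to_nat v'" by (auto simp: sel)
      show "(\<Sum>e\<in>{e\<in>bedges C. fst (ends C e) = v}. int (bwt C e) * bdir C e $ i)
        - (\<Sum>e\<in>{e\<in>bedges C. snd (ends C e) = v}. int (bwt C e) * bdir C e $ i)
        + (\<Sum>e\<in>{e\<in>uedges C. ubase C e = v}. int (uwt C e) * udir C e $ i) = 0"
        using bal[OF v'(1), of i]
          sum_to_nat[where A = E and P = "\<lambda>e. src e = v'" and g = "\<lambda>e. int (w e) * D e $ i"]
          sum_to_nat[where A = E and P = "\<lambda>e. tgt e = v'" and g = "\<lambda>e. int (w e) * D e $ i"]
          sum_to_nat[where A = F and P = "\<lambda>f. b f = v'" and g = "\<lambda>f. int (wF f) * R f $ i"]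
        by (simp add: sel v'(2))
    qed
  qed
  moreover have "support C = P ` V \<union> (\<Union>e\<in>E. open_segment (P (src e)) (P (tgt e)))
       \<union> (\<Union>f\<in>F. {P (b f) + t *\<^sub>R ivec (R f) | t. t > 0})"
    unfolding support_def posV by (simp add: sel(3,7) bint rint)
  moreover have "degree C = (\<Sum>f\<in>F. int (wF f) * Max (insert 0 (range (\<lambda>i. R f $ i))))"
    using sum_to_nat[where A = F and P = "\<lambda>_. True" and g = "\<lambda>f. int (wF f) * Max (insert 0 (range (\<lambda>i. R f $ i)))"]
    by (simp add: degree_def sel)
  moreover have "genus C = int (card E) - int (card V) + 1"
  proof -
    let ?r = "{(x, y). \<exists>e\<in>E. (src e, tgt e) = (x, y) \<or> (src e, tgt e) = (y, x)}"
    have adj: "adj C = map_prod to_nat to_nat ` ?r"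
      by (force simp: adj_def sel)
    have "(to_nat v0, to_nat v) \<in> (adj C)\<^sup>*" if "(v0, v) \<in> ?r\<^sup>*" for v
      using that
    proof induction
      case (step y z)
      then have "(to_nat y, to_nat z) \<in> adj C" using map_prod_imageI[of y z ?r to_nat to_nat] by (simp only: adj step.hyps)
      with step.IH show ?case by (rule rtrancl.rtrancl_into_rtrancl)
    qed simp
    then have "verts C // (adj C)\<^sup>* = {verts C}"
      using root conn E
      by (intro quotient_rtrancl_connected[of "to_nat v0"])
        (auto simp: sel adj_def intro!: symI)
    then show ?thesis
      by (simp add: genus_def sel card_image[OF inj_on_subset[OF inj_to_nat subset_UNIV]])
  qed
  ultimately show ?thesis by blast
qed

section \<open>Gluing plane curves along a tropical line\<close>

datatype 'v cell = Vx 'v | Ed 'v 'v | Dn 'v | LL | RR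

text \<open>The local curve placed at a vertex of the tropical line, in coordinates \<open>(u, y)\<close> centred at that
vertex. All bounded edges have weight 1. Besides rays in direction \<open>(0, -1)\<close> of weight \<open>wF v\<close> at \<open>v \<in> F\<close>,
there is one ray of weight \<open>d\<close> in direction \<open>(-1, 0)\<close> at \<open>l\<close> and one in direction \<open>(1, 1)\<close> at \<open>r\<close>; since both
lie on lines through the origin, they can be glued along the edges of the tropical line.\<close>

locale piece =
  fixes V :: "'v::countable set" and E :: "('v \<times> 'v) set" and F :: "'v set"
    and px py :: "'v \<Rightarrow> int" and dx dy :: "'v \<Rightarrow> 'v \<Rightarrow> int" and wF :: "'v \<Rightarrow> nat"
    and l r :: 'v and a :: int and d :: nat
  assumes finV: "finite V" and E_sub: "E \<subseteq> V \<times> V" and F_sub: "F \<subseteq> V"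
    and lV: "l \<in> V" and rV: "r \<in> V" and a_nonneg: "a \<ge> 0" and d_pos: "d > 0"
    and pos_l: "px l = - a" "py l = 0" and pos_r: "px r = a" "py r = a"
    and dir_coprime: "(v, w) \<in> E \<Longrightarrow> coprime (dx v w) (dy v w)"
    and dir_edge: "(v, w) \<in> E \<Longrightarrow> \<exists>t::real. t > 0 \<and> of_int (px w - px v) = t * of_int (dx v w)
        \<and> of_int (py w - py v) = t * of_int (dy v w)"
    and wF_pos: "v \<in> F \<Longrightarrow> wF v > 0"
    and bal_x: "v \<in> V \<Longrightarrow> (\<Sum>w\<in>{w. (v, w) \<in> E}. dx v w) - (\<Sum>w\<in>{w. (w, v) \<in> E}. dx w v)
        + (if v = r then int d else 0) - (if v = l then int d else 0) = 0"
    and bal_y: "v \<in> V \<Longrightarrow> (\<Sum>w\<in>{w. (v, w) \<in> E}. dy v w) - (\<Sum>w\<in>{w. (w, v) \<in> E}. dy w v)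
        - (if v \<in> F then int (wF v) else 0) + (if v = r then int d else 0) = 0"
    and conn: "v \<in> V \<Longrightarrow> (l, v) \<in> (E \<union> E\<inverse>)\<^sup>*"
begin

definition pt :: "'v \<Rightarrow> real \<times> real" where
  "pt v = (of_int (px v), of_int (py v))"

fun pts :: "'v cell \<Rightarrow> (real \<times> real) set" where
  "pts (Vx v) = {pt v}"
| "pts (Ed v w) = {(1 - t) *\<^sub>R pt v + t *\<^sub>R pt w | t. 0 < t \<and> t < 1}"
| "pts (Dn v) = {pt v - (0, t) | t. t > 0}"
| "pts LL = {(- of_int a - t, 0) | t. t > 0}"
| "pts RR = {(of_int a + t, of_int a + t) | t. t > 0}"

text \<open>\<open>LL\<close> and \<open>RR\<close> are left out: gluing merges the right ray of one
  piece with the left ray of the next into one edge.\<close>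

definition core :: "'v cell set" where
  "core = Vx ` V \<union> case_prod Ed ` E \<union> Dn ` F"

definition K :: real where
  "K = of_int (\<Sum>v\<in>V. \<bar>px v\<bar> + \<bar>py v\<bar>)"

text \<open>The chart is valid for offsets up to 1, and consecutive vertices of the line differ by 2
  along their edge. Since \<open>K < 1 / \<epsilon>\<close>, a scaled piece stays before the
  midpoint of each bounded edge.\<close>

definition \<epsilon> :: real where "\<epsilon> = 1 / (K + 1)"

lemma abs_pt_le: "v \<in> V \<Longrightarrow> of_int (\<bar>px v\<bar> + \<bar>py v\<bar>) \<le> K"
  unfolding K_def of_int_le_iff by (rule member_le_sum) (use finV in auto)

lemma K_nonneg: "K \<ge> 0"
  unfolding K_def by (simp add: sum_nonneg)

lemma a_le_K: "of_int a \<le> K"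
  using abs_pt_le[OF lV] a_nonneg by (simp add: pos_l)

lemma \<epsilon>_pos: "\<epsilon> > 0" using K_nonneg by (simp add: \<epsilon>_def)

lemma inverse_\<epsilon>: "1 / \<epsilon> = K + 1" using K_nonneg by (simp add: \<epsilon>_def)

text \<open>The bounds of \<open>plane_chart\<close> rewritten in the coordinates of a piece, with
  \<open>K\<close> in place of \<open>1 / \<epsilon>\<close>. The region is unbounded in direction
  (0, -1), so it also holds the downward rays.\<close>

definition window :: "(real \<times> real) set" where
  "window = {(u, y). \<bar>u\<bar> \<le> K \<and> y \<le> K \<and> y - u \<le> K}"

lemma convex_window: "convex window"
proof -
  have "window = {p. (1, 0) \<bullet> p \<le> K} \<inter> {p. (-1, 0) \<bullet> p \<le> K} \<inter> {p. (0, 1) \<bullet> p \<le> K} \<inter> {p. (-1, 1) \<bullet> p \<le> K}"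
    by (auto simp: window_def inner_prod_def)
  then show ?thesis by (simp add: convex_Int convex_halfspace_le)
qed

lemma pt_window: "v \<in> V \<Longrightarrow> pt v \<in> window"
  using abs_pt_le[of v] by (auto simp: window_def pt_def)

lemma core_window:
  assumes "c \<in> core" shows "pts c \<subseteq> window"
proof -
  consider v where "c = Vx v" "v \<in> V" | v w where "c = Ed v w" "(v, w) \<in> E" | v where "c = Dn v" "v \<in> F"
    using assms by (auto simp: core_def)
  then show ?thesis
  proof cases
    case 1 then show ?thesis by (simp add: pt_window)
  next
    case 2
    then have "pt v \<in> window" "pt w \<in> window" using E_sub pt_window by auto
    then show ?thesis using 2 by (auto intro!: convexD_alt[OF convex_window])
  next
    case 3
    then have "pt v \<in> window" using F_sub pt_window by auto
    then show ?thesis using 3 by (auto simp: window_def pt_def)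
  qed
qed

end

locale embedded_piece = piece +
  assumes cells_disjoint: "c \<in> core \<union> {LL, RR} \<Longrightarrow> c' \<in> core \<union> {LL, RR} \<Longrightarrow> c \<noteq> c' \<Longrightarrow> pts c \<inter> pts c' = {}"

section \<open>One chart for each vertex of the tropical line\<close>

datatype 'v gcell = Loc nat "'v cell" | Fat nat

locale chain = embedded_piece V E F px py dx dy wF l r a d + ground_order idx n
  for V :: "'v::countable set" and E F px py dx dy wF l r a d
    and idx :: "'n::finite \<Rightarrow> nat" and n +
  assumes n2: "n \<ge> 2"
begin

text \<open>Up to \<epsilon>, the directions (-1, 0), (1, 1) and (0, -1) of a piece become the sum
  of all unit vectors from index \<open>k\<close> on, minus the sum of those beyond
  \<open>k\<close>, and minus the unit vector at \<open>k\<close>: the three edges of the line at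
  its vertex number \<open>k\<close>.\<close>

definition G :: "nat \<Rightarrow> real \<times> real \<Rightarrow> real^'n" where
  "G k p = (\<chi> i. base k (idx i) + \<epsilon> * (if idx i < k then 0 else if idx i = k then snd p - fst p else - fst p))"

definition J :: "nat \<Rightarrow> int \<Rightarrow> int \<Rightarrow> int^'n" where
  "J k u y = (\<chi> i. if idx i < k then 0 else if idx i = k then y - u else - u)"

definition coord :: "real^'n \<Rightarrow> nat \<Rightarrow> real" where
  "coord x m = hcoord x (inv idx0 m)"

text \<open>\<open>proj j\<close> inverts the chart \<open>G j\<close>. It maps every other piece into one of the two rays of weight \<open>d\<close>
of piece \<open>j\<close>, which reduces the disjointness of cells in the glued curve to that in a single piece.\<close>

definition proj :: "nat \<Rightarrow> real^'n \<Rightarrow> real \<times> real" where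
  "proj j x = (- (coord x (j + 1) - coord x (j - 1)) / \<epsilon>, - (coord x (j + 1) - coord x j - 1) / \<epsilon>)"

lemma idx0_surj: "m \<le> n \<Longrightarrow> \<exists>i. idx0 i = m"
proof (cases "m = 0")
  case False
  assume "m \<le> n"
  with False have "m \<in> idx ` UNIV" using idx_bij by (auto simp: bij_betw_def)
  then show ?thesis by (metis idx0_simps(2) imageE)
qed (metis idx0_simps(1))

lemma hcoord_G:
  assumes "1 \<le> k"
  shows "hcoord (G k p) i = base k (idx0 i)
    + (if idx0 i < k then 0 else if idx0 i = k then \<epsilon> * (snd p - fst p) else - \<epsilon> * fst p)"
  using assms by (cases i) (auto simp: hcoord_def G_def base_def)

lemma coord_G:
  assumes "1 \<le> k" "m \<le> n"
  shows "coord (G k p) m = base k m + (if m < k then 0 else if m = k then \<epsilon> * (snd p - fst p) else - \<epsilon> * fst p)"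
proof -
  have "idx0 (inv idx0 m) = m" using idx0_surj[OF assms(2)] by (metis f_inv_into_f rangeI)
  then show ?thesis unfolding coord_def hcoord_G[OF assms(1)] by simp
qed

lemma proj_same:
  assumes "1 \<le> k" "k < n" shows "proj k (G k p) = p"
  using assms \<epsilon>_pos by (auto simp: proj_def coord_G base_def prod_eq_iff field_simps)

text \<open>In chart \<open>j\<close> the next vertex of the line is the point with both coordinates
  \<open>2 / \<epsilon>\<close>. Since \<open>proj j\<close> reads only the coordinates with numbers
  \<open>j - 1\<close>, \<open>j\<close>, \<open>j + 1\<close>, a piece with
  \<open>k > j + 1\<close> collapses to this point, and the piece \<open>k = j + 1\<close> collapses
  into the diagonal around it. The lemma \<open>proj_above\<close> is the analogue on the other
  side.\<close>

lemma proj_below: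
  assumes j: "1 \<le> j" "j < k" "k < n" and p: "snd p - fst p < 2 / \<epsilon> - of_int a"
  shows "proj j (G k p) \<in> pts RR"
proof -
  define \<tau> where "\<tau> = (if j = k - 1 then 2 / \<epsilon> - (snd p - fst p) else 2 / \<epsilon>)"
  have "of_int a < 2 / \<epsilon>" using inverse_\<epsilon> a_le_K K_nonneg by (simp add: field_simps)
  then have "\<tau> > of_int a" using p by (simp add: \<tau>_def)
  have "proj j (G k p) = (\<tau>, \<tau>)"
    using j \<epsilon>_pos by (auto simp: proj_def coord_G base_def \<tau>_def field_simps of_nat_diff)
  also have "\<dots> \<in> pts RR" using \<open>\<tau> > of_int a\<close> by (auto intro!: exI[of _ "\<tau> - of_int a"])
  finally show ?thesis .
qed

lemma proj_above:
  assumes j: "1 \<le> k" "k < j" "j < n" and p: "snd p < 2 / \<epsilon> - of_int a"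
  shows "proj j (G k p) \<in> pts LL"
proof -
  define \<tau> where "\<tau> = (if j = k + 1 then 2 / \<epsilon> - snd p else 2 / \<epsilon>)"
  have "of_int a < 2 / \<epsilon>" using inverse_\<epsilon> a_le_K K_nonneg by (simp add: field_simps)
  then have "\<tau> > of_int a" using p by (simp add: \<tau>_def)
  have "proj j (G k p) = (- \<tau>, 0)"
    using j \<epsilon>_pos by (auto simp: proj_def coord_G base_def \<tau>_def field_simps of_nat_diff)
  also have "\<dots> \<in> pts LL" using \<open>\<tau> > of_int a\<close> by (auto intro!: exI[of _ "\<tau> - of_int a"])
  finally show ?thesis .
qed

section \<open>Cells of the glued curve and their disjointness\<close>

definition gcells :: "'v gcell set" where
  "gcells = case_prod Loc ` ({1..<n} \<times> core) \<union> Fat ` {0..<n}"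

definition gpts :: "'v gcell \<Rightarrow> (real^'n) set" where
  "gpts g = (case g of Loc k c \<Rightarrow> G k ` pts c | Fat k \<Rightarrow>
     if k = 0 then {G 1 (- of_int a - t, 0) | t. t > 0}
     else {G k (of_int a + t, of_int a + t) | t. t > 0 \<and> (k < n - 1 \<longrightarrow> t < 2 / \<epsilon> - 2 * of_int a)})"

text \<open>The cell of a single piece into which \<open>proj j\<close> maps the cell
  \<open>g\<close>.\<close>

definition type_at :: "'v gcell \<Rightarrow> nat \<Rightarrow> 'v cell" where
  "type_at g j = (case g of Loc k c \<Rightarrow> if j < k then RR else if j = k then c else LL
     | Fat k \<Rightarrow> if j \<le> k then RR else LL)"

lemma core_not_fat: "LL \<notin> core" "RR \<notin> core"
  by (auto simp: core_def)

lemma proj_type_at: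
  assumes g: "g \<in> gcells" and x: "x \<in> gpts g" and j: "1 \<le> j" "j < n"
  shows "proj j x \<in> pts (type_at g j)"
proof -
  consider (loc) k c where "g = Loc k c" "1 \<le> k" "k < n" "c \<in> core" | (fat0) "g = Fat 0"
    | (fat) k where "g = Fat k" "1 \<le> k" "k < n"
    using g by (fastforce simp: gcells_def)
  then show ?thesis
  proof cases
    case loc
    then obtain p where p: "p \<in> pts c" "x = G k p" using x by (auto simp: gpts_def)
    then have "p \<in> window" using core_window loc by auto
    then have w: "snd p - fst p \<le> K" "snd p \<le> K" by (auto simp: window_def)
    have "K < 2 / \<epsilon> - of_int a" using inverse_\<epsilon> a_le_K by (simp add: field_simps)
    with w have "snd p - fst p < 2 / \<epsilon> - of_int a" "snd p < 2 / \<epsilon> - of_int a" by auto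
    then show ?thesis
      using proj_same[of k p] proj_below[of j k p] proj_above[of k j p] loc p j
      by (auto simp: type_at_def)
  next
    case fat0
    then obtain t where t: "t > 0" "x = G 1 (- of_int a - t, 0)" using x by (auto simp: gpts_def)
    have "0 < 2 / \<epsilon> - of_int a" using inverse_\<epsilon> a_le_K K_nonneg by (simp add: field_simps)
    then show ?thesis
      using proj_same[of 1 "(- of_int a - t, 0)"] proj_above[of 1 j "(- of_int a - t, 0)"] t fat0 j n2
      by (cases "j = 1") (auto simp: type_at_def)
  next
    case fat
    then obtain t where t: "t > 0" "x = G k (of_int a + t, of_int a + t)" "k < n - 1 \<longrightarrow> t < 2 / \<epsilon> - 2 * of_int a"
      using x by (auto simp: gpts_def)
    have "0 < 2 / \<epsilon> - of_int a" using inverse_\<epsilon> a_le_K K_nonneg by (simp add: field_simps)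
    then show ?thesis
      using proj_same[of k "(of_int a + t, of_int a + t)"] proj_below[of j k "(of_int a + t, of_int a + t)"]
        proj_above[of k j "(of_int a + t, of_int a + t)"] t fat j
      by (cases j k rule: linorder_cases) (auto simp: type_at_def)
  qed
qed

text \<open>As \<open>j\<close> grows, the types of a fat cell switch directly from
  \<open>RR\<close> to \<open>LL\<close>, while those of \<open>Loc k c\<close> read
  \<open>c\<close> once in between. As \<open>core\<close> contains neither fat type, the place of
  the switch and the entry there recover the cell.\<close>

lemma type_at_inj:
  assumes g: "g \<in> gcells" "g' \<in> gcells" and eq: "\<And>j. 1 \<le> j \<Longrightarrow> j < n \<Longrightarrow> type_at g j = type_at g' j"
  shows "g = g'"
proof -
  have *: "g = g'" if "g = Loc k c" "1 \<le> k" "k < n" "c \<in> core" "g' \<in> gcells"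
    "type_at g k = type_at g' k" for g g' k c
    using that core_not_fat by (auto simp: gcells_def type_at_def split: if_splits)
  have **: "k = k'" if "k < n" "k' < n" "\<And>j. 1 \<le> j \<Longrightarrow> j < n \<Longrightarrow> type_at (Fat k :: 'v gcell) j = type_at (Fat k') j" for k k'
    using that(3)[of "Suc k"] that(3)[of "Suc k'"] that(1,2)
    by (cases k k' rule: linorder_cases) (auto simp: type_at_def)
  show ?thesis
  proof (cases g)
    case (Loc k c)
    then show ?thesis using *[OF Loc _ _ _ g(2)] g(1) eq by (auto simp: gcells_def)
  next
    case (Fat k)
    show ?thesis
    proof (cases g')
      case (Loc k' c)
      then show ?thesis using *[OF Loc _ _ _ g(1)] g(2) eq by (auto simp: gcells_def)
    next
      case Fat': (Fat k')
      then show ?thesis using **[of k k'] Fat g eq by (auto simp: gcells_def)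
    qed
  qed
qed

lemma type_at_cell: "g \<in> gcells \<Longrightarrow> type_at g j \<in> core \<union> {LL, RR}"
  by (auto simp: gcells_def type_at_def split: if_splits)

lemma gcells_disjoint:
  assumes "g \<in> gcells" "g' \<in> gcells" "g \<noteq> g'" shows "gpts g \<inter> gpts g' = {}"
proof (rule ccontr)
  assume "gpts g \<inter> gpts g' \<noteq> {}"
  then obtain x where x: "x \<in> gpts g" "x \<in> gpts g'" by auto
  have "type_at g j = type_at g' j" if "1 \<le> j" "j < n" for j
    using proj_type_at[OF assms(1) x(1) that] proj_type_at[OF assms(2) x(2) that]
      cells_disjoint[OF type_at_cell[OF assms(1), of j] type_at_cell[OF assms(2), of j]] by blast
  then show False using type_at_inj[OF assms(1,2)] assms(3) by blast
qed

section \<open>Containment in the tropical plane\<close>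

lemma G_plane:
  assumes k: "1 \<le> k" "k < n" and right: "k < n - 1 \<Longrightarrow> \<epsilon> * fst p \<le> 1 \<and> \<epsilon> * snd p \<le> 1"
    and left: "1 < k \<Longrightarrow> \<epsilon> * (snd p - fst p) \<le> 1 \<and> - \<epsilon> * fst p \<le> 1"
  shows "G k p \<in> plane"
  by (rule plane_chart[OF k hcoord_G[OF k(1)]]) (use right left in \<open>auto simp: algebra_simps\<close>)

text \<open>Both charts parametrise the common edge, whose length in rescaled coordinates is
  \<open>2 / \<epsilon>\<close>.\<close>

lemma G_shift:
  assumes "1 \<le> k"
  shows "G k (s, s) = G (Suc k) (s - 2 / \<epsilon>, 0)"
  using \<epsilon>_pos by (auto simp: G_def base_def vec_eq_iff field_simps)

lemma \<epsilon>_mult_le: "x \<le> K + 1 \<Longrightarrow> \<epsilon> * x \<le> 1"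
  using K_nonneg by (simp add: \<epsilon>_def)

lemma gpts_plane:
  assumes g: "g \<in> gcells" shows "gpts g \<subseteq> plane"
proof
  fix x assume x: "x \<in> gpts g"
  consider (loc) k c where "g = Loc k c" "1 \<le> k" "k < n" "c \<in> core" | (fat0) "g = Fat 0"
    | (fat) k where "g = Fat k" "1 \<le> k" "k < n"
    using g by (fastforce simp: gcells_def)
  then show "x \<in> plane"
  proof cases
    case loc
    then obtain p where p: "p \<in> pts c" "x = G k p" using x by (auto simp: gpts_def)
    then have "p \<in> window" using core_window loc by auto
    then have w: "snd p - fst p \<le> K" "snd p \<le> K" "fst p \<le> K" "- fst p \<le> K" by (auto simp: window_def)
    show ?thesis unfolding p using loc w \<epsilon>_mult_le[of "fst p"] \<epsilon>_mult_le[of "snd p"]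
        \<epsilon>_mult_le[of "snd p - fst p"] \<epsilon>_mult_le[of "- fst p"]
      by (intro G_plane) auto
  next
    case fat0
    then obtain t where t: "t > 0" "x = G 1 (- of_int a - t, 0)" using x by (auto simp: gpts_def)
    have "\<epsilon> * (- of_int a - t) \<le> 1" using \<epsilon>_mult_le[of "- of_int a - t"] t a_nonneg K_nonneg by auto
    then show ?thesis unfolding t using n2 by (intro G_plane) auto
  next
    case fat
    then obtain t where t: "t > 0" "x = G k (of_int a + t, of_int a + t)" "k < n - 1 \<longrightarrow> t < 2 / \<epsilon> - 2 * of_int a"
      using x by (auto simp: gpts_def)
    let ?s = "of_int a + t"
    have s: "?s \<ge> 0" using t a_nonneg by simp
    show ?thesis
    \<comment> \<open>\<open>K + 1 = 1 / \<epsilon>\<close> is the midpoint of the fat edge: chart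
      \<open>k\<close> covers the first half, chart \<open>k + 1\<close> the second. The last fat
      cell is a ray and lies in its chart entirely.\<close>
    proof (cases "k = n - 1 \<or> ?s \<le> K + 1")
      case True
      have "0 \<le> \<epsilon> * ?s" using s \<epsilon>_pos by (intro mult_nonneg_nonneg) auto
      then have "- \<epsilon> * ?s \<le> 1" by simp
      then show ?thesis unfolding t using fat True \<epsilon>_mult_le[of ?s] by (intro G_plane) auto
    next
      case False
      then have k: "k < n - 1" using fat by auto
      define z where "z = ?s - 2 / \<epsilon>"
      have "z \<le> 0" "- z \<le> K + 1"
        using t(3) k a_nonneg False inverse_\<epsilon> by (auto simp: z_def field_simps)
      then have "- (\<epsilon> * z) \<le> 1" "\<epsilon> * z \<le> 1"
        using \<epsilon>_mult_le[of "- z"] \<epsilon>_mult_le[of z] K_nonneg by auto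
      then show ?thesis unfolding t G_shift[OF fat(2)] z_def[symmetric]
        using k by (intro G_plane) auto
    qed
  qed
qed

section \<open>The glued graph: incidences, balancing, degree and genus\<close>

definition gV :: "(nat \<times> 'v) set" where "gV = {1..<n} \<times> V"
definition gE :: "(nat \<times> 'v \<times> 'v + nat) set" where "gE = Inl ` ({1..<n} \<times> E) \<union> Inr ` {1..<n - 1}"
definition gF :: "(nat \<times> 'v + bool) set" where "gF = Inl ` ({1..<n} \<times> F) \<union> {Inr False, Inr True}"

definition gP :: "nat \<times> 'v \<Rightarrow> real^'n" where "gP kv = G (fst kv) (pt (snd kv))"

fun gsrc :: "nat \<times> 'v \<times> 'v + nat \<Rightarrow> nat \<times> 'v" where
  "gsrc (Inl (k, v, w)) = (k, v)" | "gsrc (Inr k) = (k, r)"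
fun gtgt :: "nat \<times> 'v \<times> 'v + nat \<Rightarrow> nat \<times> 'v" where
  "gtgt (Inl (k, v, w)) = (k, w)" | "gtgt (Inr k) = (Suc k, l)"
fun gdir :: "nat \<times> 'v \<times> 'v + nat \<Rightarrow> int^'n" where
  "gdir (Inl (k, v, w)) = J k (dx v w) (dy v w)" | "gdir (Inr k) = J k 1 1"
fun gw :: "nat \<times> 'v \<times> 'v + nat \<Rightarrow> nat" where
  "gw (Inl e) = 1" | "gw (Inr k) = d"
fun ecell :: "nat \<times> 'v \<times> 'v + nat \<Rightarrow> 'v gcell" where
  "ecell (Inl (k, v, w)) = Loc k (Ed v w)" | "ecell (Inr k) = Fat k"

fun gbase :: "nat \<times> 'v + bool \<Rightarrow> nat \<times> 'v" where
  "gbase (Inl kv) = kv" | "gbase (Inr False) = (1, l)" | "gbase (Inr True) = (n - 1, r)"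
fun gray :: "nat \<times> 'v + bool \<Rightarrow> int^'n" where
  "gray (Inl (k, v)) = J k 0 (- 1)" | "gray (Inr False) = J 1 (- 1) 0" | "gray (Inr True) = J (n - 1) 1 1"
fun gwF :: "nat \<times> 'v + bool \<Rightarrow> nat" where
  "gwF (Inl (k, v)) = wF v" | "gwF (Inr _) = d"
fun fcell :: "nat \<times> 'v + bool \<Rightarrow> 'v gcell" where
  "fcell (Inl (k, v)) = Loc k (Dn v)" | "fcell (Inr False) = Fat 0" | "fcell (Inr True) = Fat (n - 1)"

lemma Loc_in_gcells: "1 \<le> k \<Longrightarrow> k < n \<Longrightarrow> c \<in> core \<Longrightarrow> Loc k c \<in> gcells"
  by (force simp: gcells_def)

lemma Fat_in_gcells: "k < n \<Longrightarrow> Fat k \<in> gcells"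
  by (simp add: gcells_def)

lemma core_intros: "v \<in> V \<Longrightarrow> Vx v \<in> core" "(v, w) \<in> E \<Longrightarrow> Ed v w \<in> core" "v \<in> F \<Longrightarrow> Dn v \<in> core"
  by (force simp: core_def)+

lemma disjoint_subcells:
  "A \<subseteq> gpts g \<Longrightarrow> B \<subseteq> gpts g' \<Longrightarrow> g \<in> gcells \<Longrightarrow> g' \<in> gcells \<Longrightarrow> g \<noteq> g' \<Longrightarrow> A \<inter> B = {}"
  using gcells_disjoint by blast

lemma G_translate: "G k p + (\<epsilon> * t) *\<^sub>R ivec (J k u y) = G k (p + t *\<^sub>R (of_int u, of_int y))"
  by (auto simp: G_def J_def ivec_def vec_eq_iff algebra_simps)

lemma G_convex: "(1 - t) *\<^sub>R G k p + t *\<^sub>R G k q = G k ((1 - t) *\<^sub>R p + t *\<^sub>R q)"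
  by (auto simp: G_def vec_eq_iff algebra_simps)

lemma ex_idx: "1 \<le> k \<Longrightarrow> k \<le> n \<Longrightarrow> \<exists>i. idx i = k"
  using idx_bij unfolding bij_betw_def by (metis atLeastAtMost_iff imageE)

text \<open>The entries at positions \<open>k\<close> and \<open>k + 1\<close> are
  \<open>y - u\<close> and \<open>- u\<close>, a unimodular transform of (u, y), so a common divisor
  of all entries divides both \<open>u\<close> and \<open>y\<close>.\<close>

lemma primitive_J:
  assumes k: "1 \<le> k" "k < n" and "coprime u y"
  shows "primitive (J k u y)"
proof -
  obtain i i' where i: "idx i = k" "idx i' = Suc k" using ex_idx[of k] ex_idx[of "Suc k"] k by auto
  then have J: "J k u y $ i = y - u" "J k u y $ i' = - u" by (auto simp: J_def)
  have unit: "\<bar>c\<bar> = 1" if "\<forall>i. c dvd J k u y $ i" for c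
  proof -
    have "c dvd y - u" "c dvd - u" using that J by metis+
    then have "c dvd u" "c dvd y" using dvd_diff[of c "y - u" "- u"] by auto
    with \<open>coprime u y\<close> show ?thesis using coprime_common_divisor_int by blast
  qed
  \<comment> \<open>Divisibility by 0 of every entry would mean that the vector vanishes.\<close>
  moreover from unit[of 0] have "J k u y \<noteq> 0" by auto
  ultimately show ?thesis by (auto simp: primitive_def)
qed

lemma pt_lr: "pt l = (- of_int a, 0)" "pt r = (of_int a, of_int a)"
  by (simp_all add: pt_def pos_l pos_r)

lemma Inr_len: "2 / \<epsilon> - 2 * of_int a > 0"
  using inverse_\<epsilon> a_le_K by (simp add: field_simps)

lemma fat_target: "G (Suc k) (- of_int a, 0) = G k ((of_int a, of_int a) + (2 / \<epsilon> - 2 * of_int a) *\<^sub>R (1, 1))"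
  if "1 \<le> k"
  using G_shift[OF that, of "2 / \<epsilon> - of_int a"] by (simp add: algebra_simps)

lemma edge_vector:
  assumes "e \<in> gE"
  shows "\<exists>t>0. gP (gtgt e) - gP (gsrc e) = t *\<^sub>R ivec (gdir e)"
proof -
  consider k v w where "e = Inl (k, v, w)" "(v, w) \<in> E" | k where "e = Inr k" "1 \<le> k"
    using assms by (auto simp: gE_def)
  then show ?thesis
  proof cases
    case 1
    obtain t :: real where t: "t > 0" "of_int (px w - px v) = t * of_int (dx v w)"
      "of_int (py w - py v) = t * of_int (dy v w)" using dir_edge[OF 1(2)] by blast
    then have "pt w = pt v + t *\<^sub>R (of_int (dx v w), of_int (dy v w))"
      by (auto simp: pt_def algebra_simps)
    then have "G k (pt w) = G k (pt v) + (\<epsilon> * t) *\<^sub>R ivec (J k (dx v w) (dy v w))"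
      by (simp only: G_translate)
    then show ?thesis
      using 1 t(1) \<epsilon>_pos by (intro exI[of _ "\<epsilon> * t"]) (auto simp: gP_def)
  next
    case 2
    then have "gP (gtgt e) = gP (gsrc e) + (\<epsilon> * (2 / \<epsilon> - 2 * of_int a)) *\<^sub>R ivec (gdir e)"
      by (simp only: gP_def gsrc.simps gtgt.simps gdir.simps fst_conv snd_conv pt_lr fat_target
          G_translate of_int_1)
    then show ?thesis
      using \<epsilon>_pos Inr_len by (intro exI[of _ "\<epsilon> * (2 / \<epsilon> - 2 * of_int a)"] conjI mult_pos_pos) simp_all
  qed
qed

lemma edge_ecell:
  assumes "e \<in> gE"
  shows "ecell e \<in> gcells" "open_segment (gP (gsrc e)) (gP (gtgt e)) \<subseteq> gpts (ecell e)"
proof -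
  show "ecell e \<in> gcells" using assms by (auto simp: gE_def intro!: Loc_in_gcells Fat_in_gcells core_intros)
  consider k v w where "e = Inl (k, v, w)" "(v, w) \<in> E" | k where "e = Inr k" "1 \<le> k" "k < n - 1"
    using assms by (auto simp: gE_def)
  then show "open_segment (gP (gsrc e)) (gP (gtgt e)) \<subseteq> gpts (ecell e)"
  proof cases
    case 1
    then show ?thesis by (auto simp: in_segment gP_def gpts_def G_convex intro!: imageI)
  next
    case 2
    show ?thesis
    proof
      fix x assume "x \<in> open_segment (gP (gsrc e)) (gP (gtgt e))"
      then obtain t where t: "0 < t" "t < 1" "x = (1 - t) *\<^sub>R gP (gsrc e) + t *\<^sub>R gP (gtgt e)"
        by (auto simp: in_segment)
      moreover have "\<dots> = G k (pt r + (t * (2 / \<epsilon> - 2 * of_int a)) *\<^sub>R (1, 1))"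
        using 2 by (simp only: gP_def gsrc.simps gtgt.simps fst_conv snd_conv pt_lr fat_target G_convex)
          (simp add: algebra_simps)
      moreover have "t * (2 / \<epsilon> - 2 * of_int a) < 1 * (2 / \<epsilon> - 2 * of_int a)"
        using t Inr_len by (intro mult_strict_right_mono) auto
      ultimately show "x \<in> gpts (ecell e)"
        using 2 Inr_len by (auto simp: gpts_def pt_lr intro!: exI[of _ "t * (2 / \<epsilon> - 2 * of_int a)"])
    qed
  qed
qed

lemma ray_fcell:
  assumes "f \<in> gF"
  shows "fcell f \<in> gcells" "{gP (gbase f) + t *\<^sub>R ivec (gray f) | t. t > 0} \<subseteq> gpts (fcell f)"
proof -
  show "fcell f \<in> gcells" using assms n2 by (auto simp: gF_def intro!: Loc_in_gcells Fat_in_gcells core_intros)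
  show "{gP (gbase f) + t *\<^sub>R ivec (gray f) | t. t > 0} \<subseteq> gpts (fcell f)"
  proof
    fix x assume "x \<in> {gP (gbase f) + t *\<^sub>R ivec (gray f) | t. t > 0}"
    then obtain t where t: "t > 0" "x = gP (gbase f) + t *\<^sub>R ivec (gray f)" by blast
    define s where "s = t / \<epsilon>"
    have s: "s > 0" "t = \<epsilon> * s" using t \<epsilon>_pos by (auto simp: s_def)
    consider k v where "f = Inl (k, v)" | "f = Inr False" | "f = Inr True"
      by (cases f rule: fcell.cases) auto
    then show "x \<in> gpts (fcell f)"
    proof cases
      case 1
      then have "x = G k (pt v - (0, s))" by (simp add: t(2) s(2) gP_def G_translate pt_def)
      moreover have "pt v - (0, s) \<in> pts (Dn v)" using s(1) by auto
      ultimately show ?thesis using 1 by (simp add: gpts_def)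
    next
      case 2
      then have "x = G 1 (- of_int a - s, 0)" by (simp add: t(2) s(2) gP_def G_translate[of 1, simplified] pt_lr)
      then show ?thesis using 2 s(1) by (auto simp: gpts_def intro!: exI[of _ s])
    next
      case 3
      then have "x = G (n - 1) (of_int a + s, of_int a + s)" by (simp add: t(2) s(2) gP_def G_translate pt_lr)
      then show ?thesis using 3 s(1) n2 by (auto simp: gpts_def intro!: exI[of _ s])
    qed
  qed
qed

lemma J_linear: "J k u y $ i = J k 1 0 $ i * u + J k 0 1 $ i * y"
  by (auto simp: J_def)

lemma J_glue: "1 < k \<Longrightarrow> J (k - 1) 1 1 = J k 1 0"
  by (auto simp: J_def vec_eq_iff)

text \<open>The entry of \<open>J k u y\<close> is linear in \<open>u\<close> and \<open>y\<close>,
  so the sum is \<open>A\<close> times the horizontal plus \<open>B\<close> times the vertical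
  balance of the piece. A fat edge contributes exactly what the missing local ray would:
  \<open>J_glue\<close> identifies direction (1, 1) of one chart with (1, 0) of the next.\<close>

lemma balanced_global:
  assumes "kv \<in> gV"
  shows "(\<Sum>e\<in>{e\<in>gE. gsrc e = kv}. int (gw e) * gdir e $ i)
       - (\<Sum>e\<in>{e\<in>gE. gtgt e = kv}. int (gw e) * gdir e $ i)
       + (\<Sum>f\<in>{f\<in>gF. gbase f = kv}. int (gwF f) * gray f $ i) = 0"
proof -
  obtain k v where kv: "kv = (k, v)" and k: "1 \<le> k" "k < n" and v: "v \<in> V"
    using assms by (auto simp: gV_def)
  define A B where "A = J k 1 0 $ i" and "B = J k 0 1 $ i"
  have q: "J k u y $ i = A * u + B * y" for u y unfolding A_def B_def by (rule J_linear)
  let ?out = "{w. (v, w) \<in> E}" and ?in = "{w. (w, v) \<in> E}"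
  have fin: "finite ?out" "finite ?in"
    by (rule finite_subset[OF _ finV], use E_sub in auto)+
  have out: "{e\<in>gE. gsrc e = kv} = (\<lambda>w. Inl (k, v, w)) ` ?out \<union> (if v = r \<and> k < n - 1 then {Inr k} else {})"
    using k by (auto simp: gE_def kv)
  have "in": "{e\<in>gE. gtgt e = kv} = (\<lambda>w. Inl (k, w, v)) ` ?in \<union> (if v = l \<and> 1 < k then {Inr (k - 1)} else {})"
    using k by (auto simp: gE_def kv image_iff)
  have split: "sum h (\<phi> ` S \<union> X) = (\<Sum>w\<in>S. h (\<phi> w)) + sum h X"
    if "inj \<phi>" "finite S" "finite X" "\<phi> ` S \<inter> X = {}"
    for h :: "nat \<times> 'v \<times> 'v + nat \<Rightarrow> int" and \<phi> :: "'v \<Rightarrow> _" and S X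
    using that by (simp add: sum.union_disjoint sum.reindex[OF inj_on_subset[OF that(1) subset_UNIV]])
  have 1: "(\<Sum>e\<in>{e\<in>gE. gsrc e = kv}. int (gw e) * gdir e $ i)
      = A * (\<Sum>w\<in>?out. dx v w) + B * (\<Sum>w\<in>?out. dy v w)
        + (if v = r \<and> k < n - 1 then int d * (A + B) else 0)"
  proof -
    have "(\<Sum>e\<in>{e\<in>gE. gsrc e = kv}. int (gw e) * gdir e $ i) = (\<Sum>w\<in>?out. A * dx v w + B * dy v w)
        + (\<Sum>e\<in>(if v = r \<and> k < n - 1 then {Inr k} else {}). int (gw e) * gdir e $ i)"
      unfolding out by (subst split) (use fin in \<open>auto simp: inj_on_def q\<close>)
    then show ?thesis by (simp add: q sum.distrib sum_distrib_left)
  qed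
  have 2: "(\<Sum>e\<in>{e\<in>gE. gtgt e = kv}. int (gw e) * gdir e $ i)
      = A * (\<Sum>w\<in>?in. dx w v) + B * (\<Sum>w\<in>?in. dy w v)
        + (if v = l \<and> 1 < k then int d * A else 0)"
  proof -
    have "(\<Sum>e\<in>{e\<in>gE. gtgt e = kv}. int (gw e) * gdir e $ i) = (\<Sum>w\<in>?in. A * dx w v + B * dy w v)
        + (\<Sum>e\<in>(if v = l \<and> 1 < k then {Inr (k - 1)} else {}). int (gw e) * gdir e $ i)"
      unfolding "in" by (subst split) (use fin in \<open>auto simp: inj_on_def q\<close>)
    moreover have "J (k - 1) 1 1 $ i = A" if "1 < k"
      unfolding J_glue[OF that] by (simp add: q)
    ultimately show ?thesis by (simp add: sum.distrib sum_distrib_left)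
  qed
  have 3: "(\<Sum>f\<in>{f\<in>gF. gbase f = kv}. int (gwF f) * gray f $ i)
      = - (if v \<in> F then int (wF v) * B else 0) - (if v = l \<and> k = 1 then int d * A else 0)
        + (if v = r \<and> k = n - 1 then int d * (A + B) else 0)"
  proof -
    have finF: "finite ({1..<n} \<times> F)" using F_sub finV by (auto intro: finite_subset)
    let ?h = "\<lambda>f. if gbase f = kv then int (gwF f) * gray f $ i else 0"
    have "(\<Sum>f\<in>{f\<in>gF. gbase f = kv}. int (gwF f) * gray f $ i) = sum ?h gF"
      using finF by (intro sum.inter_filter) (simp add: gF_def)
    also have "\<dots> = (\<Sum>x\<in>{1..<n} \<times> F. ?h (Inl x)) + (?h (Inr False) + ?h (Inr True))"
      using finF unfolding gF_def by (subst sum.union_disjoint) (auto simp: sum.reindex)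
    also have "(\<Sum>x\<in>{1..<n} \<times> F. ?h (Inl x)) = (\<Sum>x\<in>{1..<n} \<times> F. if x = kv then - (int (wF v) * B) else 0)"
      by (rule sum.cong) (auto simp: kv q)
    also have "\<dots> = - (if v \<in> F then int (wF v) * B else 0)"
      using finF k by (simp add: kv)
    also have "?h (Inr False) = - (if v = l \<and> k = 1 then int d * A else 0)"
      using q by (auto simp: kv)
    also have "?h (Inr True) = (if v = r \<and> k = n - 1 then int d * (A + B) else 0)"
      using q by (auto simp: kv)
    finally show ?thesis by simp
  qed
  have "A * ((\<Sum>w\<in>?out. dx v w) - (\<Sum>w\<in>?in. dx w v)
        + (if v = r then int d else 0) - (if v = l then int d else 0))
      + B * ((\<Sum>w\<in>?out. dy v w) - (\<Sum>w\<in>?in. dy w v)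
        - (if v \<in> F then int (wF v) else 0) + (if v = r then int d else 0)) = 0"
    using bal_x[OF v] bal_y[OF v] by simp
  then show ?thesis
    unfolding 1 2 3 using k by (auto simp: algebra_simps)
qed

lemma gvertex_cell:
  assumes "kv \<in> gV"
  shows "Loc (fst kv) (Vx (snd kv)) \<in> gcells" "gP kv \<in> gpts (Loc (fst kv) (Vx (snd kv)))"
  using assms by (auto simp: gV_def gpts_def gP_def intro!: Loc_in_gcells core_intros)

lemma connected_global:
  assumes "kv \<in> gV"
  shows "((1, l), kv) \<in> {(x, y). \<exists>e\<in>gE. (gsrc e, gtgt e) = (x, y) \<or> (gsrc e, gtgt e) = (y, x)}\<^sup>*"
    (is "_ \<in> ?r\<^sup>*")
proof -
  have local: "((k, l), (k, v)) \<in> ?r\<^sup>*" if k: "1 \<le> k" "k < n" and v: "v \<in> V" for k v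
    using conn[OF v]
  proof induction
    case (step y z)
    then have "Inl (k, y, z) \<in> gE \<or> Inl (k, z, y) \<in> gE" using k by (auto simp: gE_def)
    then have "((k, y), (k, z)) \<in> ?r" by force
    with step.IH show ?case by (rule rtrancl.rtrancl_into_rtrancl)
  qed simp
  have start: "Suc k < n \<Longrightarrow> ((1, l), (Suc k, l)) \<in> ?r\<^sup>*" for k
  proof (induction k)
    case (Suc k)
    then have "((1, l), (Suc k, r)) \<in> ?r\<^sup>*"
      using local[of "Suc k", OF _ _ rV] by (auto intro: rtrancl_trans)
    moreover have "Inr (Suc k) \<in> gE" using Suc.prems by (auto simp: gE_def)
    then have "((Suc k, r), (Suc (Suc k), l)) \<in> ?r" by force
    ultimately show ?case by (rule rtrancl.rtrancl_into_rtrancl)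
  qed simp
  obtain k v where kv: "kv = (Suc k, v)" "Suc k < n" "v \<in> V"
    using assms by (auto simp: gV_def) (metis Suc_le_D)
  then show ?thesis using start[of k] local[of "Suc k" v] by (auto intro: rtrancl_trans)
qed

lemma ex_planar_curve:
  "\<exists>C :: 'n tcurve. tropical_curve C \<and> planar C \<and> degree C = int d \<and>
     genus C = (int n - 1) * (int (card E) - int (card V) + 1)"
proof -
  have finE: "finite E" using E_sub finV by (metis finite_SigmaI finite_subset)
  have finF: "finite F" using F_sub finV finite_subset by blast
  have e_prim: "primitive (gdir e)" if "e \<in> gE" for e
    using that dir_coprime by (auto simp: gE_def intro!: primitive_J)
  have f_prim: "primitive (gray f)" if "f \<in> gF" for f
    using that n2 by (auto simp: gF_def intro!: primitive_J)
  have "\<exists>C :: 'n tcurve. tropical_curve C \<and>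
     support C = gP ` gV \<union> (\<Union>e\<in>gE. open_segment (gP (gsrc e)) (gP (gtgt e)))
       \<union> (\<Union>f\<in>gF. {gP (gbase f) + t *\<^sub>R ivec (gray f) | t. t > 0}) \<and>
     degree C = (\<Sum>f\<in>gF. int (gwF f) * Max (insert 0 (range (\<lambda>i. gray f $ i)))) \<and>
     genus C = int (card gE) - int (card gV) + 1"
  proof (rule relabelled_curve[where w = gw and ?v0.0 = "(1, l)"])
    show "finite gV" "finite gE" "finite gF"
      using finV finE finF by (auto simp: gV_def gE_def gF_def)
    show "gsrc e \<in> gV \<and> gtgt e \<in> gV \<and> gw e > 0 \<and> primitive (gdir e) \<and>
       (\<exists>t>0. gP (gtgt e) - gP (gsrc e) = t *\<^sub>R ivec (gdir e))" if "e \<in> gE" for e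
      using that E_sub lV rV d_pos edge_vector[OF that] e_prim[OF that] by (auto simp: gE_def gV_def)
    show "gbase f \<in> gV \<and> gwF f > 0 \<and> primitive (gray f)" if "f \<in> gF" for f
      using that F_sub lV rV d_pos n2 wF_pos f_prim[OF that] by (auto simp: gF_def gV_def)
    show "inj_on gP gV"
    proof (rule inj_onI)
      fix x y assume x: "x \<in> gV" and y: "y \<in> gV" and eq: "gP x = gP y"
      have "Loc (fst x) (Vx (snd x)) = Loc (fst y) (Vx (snd y))"
        using gcells_disjoint[OF gvertex_cell(1)[OF x] gvertex_cell(1)[OF y]]
          gvertex_cell(2)[OF x] gvertex_cell(2)[OF y] eq by auto
      then show "x = y" by (simp add: prod_eq_iff)
    qed
    show "open_segment (gP (gsrc e)) (gP (gtgt e)) \<inter> gP ` gV = {}" if e: "e \<in> gE" for e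
    proof -
      have ne: "ecell e \<noteq> Loc k (Vx v)" for k v by (cases e rule: ecell.cases) auto
      have "open_segment (gP (gsrc e)) (gP (gtgt e)) \<inter> {gP x} = {}" if "x \<in> gV" for x
        by (rule disjoint_subcells[OF edge_ecell(2)[OF e] _ edge_ecell(1)[OF e] gvertex_cell(1)[OF that] ne])
          (use gvertex_cell(2)[OF that] in simp)
      then show ?thesis by blast
    qed
    show "{gP (gbase f) + t *\<^sub>R ivec (gray f) | t. t > 0} \<inter> gP ` gV = {}" if f: "f \<in> gF" for f
    proof -
      have ne: "fcell f \<noteq> Loc k (Vx v)" for k v by (cases f rule: fcell.cases) auto
      have "{gP (gbase f) + t *\<^sub>R ivec (gray f) | t. t > 0} \<inter> {gP x} = {}" if "x \<in> gV" for x
        by (rule disjoint_subcells[OF ray_fcell(2)[OF f] _ ray_fcell(1)[OF f] gvertex_cell(1)[OF that] ne])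
          (use gvertex_cell(2)[OF that] in simp)
      then show ?thesis by (simp only: disjoint_iff image_iff) blast
    qed
    show "open_segment (gP (gsrc e)) (gP (gtgt e)) \<inter> open_segment (gP (gsrc e')) (gP (gtgt e')) = {}"
      if e: "e \<in> gE" and e': "e' \<in> gE" and "e \<noteq> e'" for e e'
    proof -
      have "ecell e \<noteq> ecell e'" using \<open>e \<noteq> e'\<close>
        by (cases e rule: ecell.cases; cases e' rule: ecell.cases) auto
      then show ?thesis
        by (rule disjoint_subcells[OF edge_ecell(2)[OF e] edge_ecell(2)[OF e'] edge_ecell(1)[OF e] edge_ecell(1)[OF e']])
    qed
    show "{gP (gbase f) + t *\<^sub>R ivec (gray f) | t. t > 0} \<inter> {gP (gbase f') + t *\<^sub>R ivec (gray f') | t. t > 0} = {}"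
      if f: "f \<in> gF" and f': "f' \<in> gF" and "f \<noteq> f'" for f f'
    proof -
      have "fcell f \<noteq> fcell f'" using \<open>f \<noteq> f'\<close> n2
        by (cases f rule: fcell.cases; cases f' rule: fcell.cases) auto
      then show ?thesis
        by (rule disjoint_subcells[OF ray_fcell(2)[OF f] ray_fcell(2)[OF f'] ray_fcell(1)[OF f] ray_fcell(1)[OF f']])
    qed
    show "open_segment (gP (gsrc e)) (gP (gtgt e)) \<inter> {gP (gbase f) + t *\<^sub>R ivec (gray f) | t. t > 0} = {}"
      if e: "e \<in> gE" and f: "f \<in> gF" for e f
    proof -
      have "ecell e \<noteq> fcell f" using n2 e
        by (cases e rule: ecell.cases; cases f rule: fcell.cases) (auto simp: gE_def)
      then show ?thesis
        by (rule disjoint_subcells[OF edge_ecell(2)[OF e] ray_fcell(2)[OF f] edge_ecell(1)[OF e] ray_fcell(1)[OF f]])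
    qed
    show "(1, l) \<in> gV" using n2 lV by (simp add: gV_def)
  qed (rule balanced_global connected_global; assumption)+
  then obtain C :: "'n tcurve" where C: "tropical_curve C"
    and supp: "support C = gP ` gV \<union> (\<Union>e\<in>gE. open_segment (gP (gsrc e)) (gP (gtgt e)))
       \<union> (\<Union>f\<in>gF. {gP (gbase f) + t *\<^sub>R ivec (gray f) | t. t > 0})"
    and deg: "degree C = (\<Sum>f\<in>gF. int (gwF f) * Max (insert 0 (range (\<lambda>i. gray f $ i))))"
    and gen: "genus C = int (card gE) - int (card gV) + 1" by blast
  have "support C \<subseteq> plane"
    unfolding supp
  proof (intro Un_least UN_least)
    show "gP ` gV \<subseteq> plane" using gvertex_cell gpts_plane by blast
    show "open_segment (gP (gsrc e)) (gP (gtgt e)) \<subseteq> plane" if "e \<in> gE" for e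
      by (rule order_trans[OF edge_ecell(2)[OF that] gpts_plane[OF edge_ecell(1)[OF that]]])
    show "{gP (gbase f) + t *\<^sub>R ivec (gray f) | t. t > 0} \<subseteq> plane" if "f \<in> gF" for f
      by (rule order_trans[OF ray_fcell(2)[OF that] gpts_plane[OF ray_fcell(1)[OF that]]])
  qed
  then have "planar C" using tropical_plane_plane[OF n2] by (auto simp: planar_def)
  moreover have "degree C = int d"
  proof -
    \<comment> \<open>The leftmost ray has direction (1, ..., 1); every other ray direction has no
      positive entry. Hence the degree is the weight of this one ray.\<close>
    have nonpos: "Max (insert 0 (range (\<lambda>i. J k u y $ i))) = 0" if "0 \<le> u" "y \<le> u" for k u y
      using that by (intro Max_eqI) (auto simp: J_def)
    have one: "range (\<lambda>i. J 1 (- 1) 0 $ i) = {1}"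
    proof -
      have "J 1 (- 1) 0 $ i = 1" for i using idx_bounds(1)[of i] by (auto simp: J_def)
      then show ?thesis by auto
    qed
    have "int (gwF f) * Max (insert 0 (range (\<lambda>i. gray f $ i))) = (if f = Inr False then int d else 0)" for f
      by (cases f rule: fcell.cases) (simp_all only: gray.simps gwF.simps nonpos one, simp_all)
    then show ?thesis unfolding deg using finF by (simp add: gF_def)
  qed
  moreover have "genus C = (int n - 1) * (int (card E) - int (card V) + 1)"
  proof -
    \<comment> \<open>The \<open>n - 2\<close> fat edges join the \<open>n - 1\<close> pieces in a
      path, so they create no new cycle.\<close>
    have "card gE = (n - 1) * card E + (n - 2)"
      unfolding gE_def using finE
      by (subst card_Un_disjoint) (auto simp: card_image card_cartesian_product)
    moreover obtain m where "n = m + 2" using n2 by (metis add.commute le_Suc_ex)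
    ultimately show ?thesis
      unfolding gen gV_def by (simp add: card_cartesian_product algebra_simps)
  qed
  ultimately show ?thesis using C by blast
qed

end

section \<open>Cells of a tropical curve and dominating monomials\<close>

text \<open>This is the empty circumscribed ellipse of a unimodular triangle: a positive definite
  quadratic form minus a linear one, which vanishes at three lattice points and is positive at all
  others. It shows that \<open>cc\<close> induces the honeycomb subdivision.\<close>

lemma hex_form_nonneg:
  fixes x z :: int
  shows "x * x - x * z + z * z - z \<ge> 0"
    and "x * x - x * z + z * z - z = 0 \<longleftrightarrow> x = 0 \<and> z = 0 \<or> x = 0 \<and> z = 1 \<or> x = 1 \<and> z = 1"
proof -
  have eq: "4 * (x * x - x * z + z * z - z) = (2 * x - z)\<^sup>2 + z * (3 * z - 4)"
    by (simp add: power2_eq_square algebra_simps)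
  consider "z \<le> - 1" | "z = 0" | "z = 1" | "z \<ge> 2" by linarith
  then have "x * x - x * z + z * z - z \<ge> 0 \<and>
    (x * x - x * z + z * z - z = 0 \<longleftrightarrow> x = 0 \<and> z = 0 \<or> x = 0 \<and> z = 1 \<or> x = 1 \<and> z = 1)"
  proof cases
    case 1
    then have "z * (3 * z - 4) > 0" by (intro mult_neg_neg) auto
    then have "4 * (x * x - x * z + z * z - z) > 0" unfolding eq by (intro add_nonneg_pos) auto
    then have "x * x - x * z + z * z - z > 0" by (simp add: zero_less_mult_iff)
    with 1 show ?thesis by auto
  next
    case 3
    have "x * (x - 1) \<ge> 0" by (cases "x \<le> 0") (auto intro: mult_nonpos_nonpos)
    moreover have "x * (x - 1) = 0 \<longleftrightarrow> x = 0 \<or> x = 1" by simp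
    ultimately show ?thesis using 3 by (auto simp: algebra_simps)
  next
    case 4
    then have "z * (3 * z - 4) > 0" by (intro mult_pos_pos) auto
    then have "4 * (x * x - x * z + z * z - z) > 0" unfolding eq by (intro add_nonneg_pos) auto
    then have "x * x - x * z + z * z - z > 0" by (simp add: zero_less_mult_iff)
    with 4 show ?thesis by auto
  qed simp
  then show "x * x - x * z + z * z - z \<ge> 0"
    and "x * x - x * z + z * z - z = 0 \<longleftrightarrow> x = 0 \<and> z = 0 \<or> x = 0 \<and> z = 1 \<or> x = 1 \<and> z = 1"
    by blast+
qed

definition tval :: "(nat \<times> nat \<Rightarrow> int) \<Rightarrow> nat \<times> nat \<Rightarrow> real \<times> real \<Rightarrow> real" where
  "tval c \<mu> p = real (snd \<mu>) * fst p - real (fst \<mu>) * snd p + of_int (c \<mu>)"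

definition dominant :: "(nat \<times> nat \<Rightarrow> int) \<Rightarrow> (nat \<times> nat) set \<Rightarrow> real \<times> real \<Rightarrow> (nat \<times> nat) set \<Rightarrow> bool" where
  "dominant c M p X \<longleftrightarrow> X \<noteq> {} \<and> X \<subseteq> M \<and> (\<exists>T. \<forall>\<mu>\<in>M. tval c \<mu> p \<le> T \<and> (tval c \<mu> p = T \<longleftrightarrow> \<mu> \<in> X))"

text \<open>The reason why cells that meet have the same label.\<close>

lemma dominant_unique:
  assumes "dominant c M p X" "dominant c M p Y"
  shows "X = Y"
proof -
  obtain T where X: "X \<noteq> {}" "X \<subseteq> M" "\<And>\<mu>. \<mu> \<in> M \<Longrightarrow> tval c \<mu> p \<le> T \<and> (tval c \<mu> p = T \<longleftrightarrow> \<mu> \<in> X)"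
    using assms(1) by (auto simp: dominant_def)
  obtain T' where Y: "Y \<noteq> {}" "Y \<subseteq> M" "\<And>\<mu>. \<mu> \<in> M \<Longrightarrow> tval c \<mu> p \<le> T' \<and> (tval c \<mu> p = T' \<longleftrightarrow> \<mu> \<in> Y)"
    using assms(2) by (auto simp: dominant_def)
  obtain x y where "x \<in> X" "y \<in> Y" using X Y by blast
  then have "T = T'" using X(2) X(3)[of x] X(3)[of y] Y(2) Y(3)[of x] Y(3)[of y] by force
  then show ?thesis using X Y by blast
qed

lemma tval_convex:
  "tval c \<mu> ((1 - t) *\<^sub>R p + t *\<^sub>R q) = (1 - t) * tval c \<mu> p + t * tval c \<mu> q"
  by (simp add: tval_def algebra_simps)

text \<open>Terms are affine. Once some term is maximal at both ends, a term is maximal at an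
  interior point exactly if it is maximal at both ends.\<close>

lemma dominant_segment:
  assumes X: "dominant c M p X" and Y: "dominant c M q Y" and ne: "X \<inter> Y \<noteq> {}" and t: "0 < t" "t < 1"
  shows "dominant c M ((1 - t) *\<^sub>R p + t *\<^sub>R q) (X \<inter> Y)"
proof -
  obtain T where T: "X \<subseteq> M" "\<And>\<mu>. \<mu> \<in> M \<Longrightarrow> tval c \<mu> p \<le> T \<and> (tval c \<mu> p = T \<longleftrightarrow> \<mu> \<in> X)"
    using X by (auto simp: dominant_def)
  obtain T' where T': "\<And>\<mu>. \<mu> \<in> M \<Longrightarrow> tval c \<mu> q \<le> T' \<and> (tval c \<mu> q = T' \<longleftrightarrow> \<mu> \<in> Y)"
    using Y by (auto simp: dominant_def)
  have "tval c \<mu> ((1 - t) *\<^sub>R p + t *\<^sub>R q) \<le> (1 - t) * T + t * T' \<and>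
     (tval c \<mu> ((1 - t) *\<^sub>R p + t *\<^sub>R q) = (1 - t) * T + t * T' \<longleftrightarrow> \<mu> \<in> X \<inter> Y)" if "\<mu> \<in> M" for \<mu>
  proof -
    have le: "(1 - t) * tval c \<mu> p \<le> (1 - t) * T" "t * tval c \<mu> q \<le> t * T'"
      using T(2)[OF that] T'[OF that] t by (auto intro: mult_left_mono)
    have "(1 - t) * tval c \<mu> p = (1 - t) * T \<longleftrightarrow> \<mu> \<in> X" "t * tval c \<mu> q = t * T' \<longleftrightarrow> \<mu> \<in> Y"
      using T(2)[OF that] T'[OF that] t by auto
    with le show ?thesis unfolding tval_convex by (smt (verit) Int_iff)
  qed
  then show ?thesis using ne T(1) unfolding dominant_def by blast
qed

text \<open>Along the ray, \<sigma> bounds the growth rate of all terms, so the survivors are the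
  maximal terms at the start that grow at rate \<sigma>.\<close>

lemma dominant_ray:
  assumes X: "dominant c M p X" and t: "t > 0"
    and \<sigma>: "\<And>\<mu>. \<mu> \<in> M \<Longrightarrow> real (snd \<mu>) * fst v - real (fst \<mu>) * snd v \<le> \<sigma>"
    and Y: "Y \<noteq> {}" "Y \<subseteq> X"
      "\<And>\<mu>. \<mu> \<in> X \<Longrightarrow> real (snd \<mu>) * fst v - real (fst \<mu>) * snd v = \<sigma> \<longleftrightarrow> \<mu> \<in> Y"
  shows "dominant c M (p + t *\<^sub>R v) Y"
proof -
  obtain T where T: "X \<subseteq> M" "\<And>\<mu>. \<mu> \<in> M \<Longrightarrow> tval c \<mu> p \<le> T \<and> (tval c \<mu> p = T \<longleftrightarrow> \<mu> \<in> X)"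
    using X by (auto simp: dominant_def)
  have "tval c \<mu> (p + t *\<^sub>R v) \<le> T + t * \<sigma> \<and> (tval c \<mu> (p + t *\<^sub>R v) = T + t * \<sigma> \<longleftrightarrow> \<mu> \<in> Y)" if "\<mu> \<in> M" for \<mu>
  proof -
    define s where "s = real (snd \<mu>) * fst v - real (fst \<mu>) * snd v"
    have eq: "tval c \<mu> (p + t *\<^sub>R v) = tval c \<mu> p + t * s"
      by (simp add: tval_def s_def algebra_simps)
    have le: "t * s \<le> t * \<sigma>" using \<sigma>[OF that] t by (auto simp: s_def intro: mult_left_mono)
    have "t * s = t * \<sigma> \<longleftrightarrow> s = \<sigma>" using t by auto
    with le T(2)[OF that] Y(2) Y(3)[of \<mu>] show ?thesis unfolding eq s_def[symmetric] by auto
  qed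
  then show ?thesis using Y(1,2) T(1) unfolding dominant_def by blast
qed

fun lex_less :: "nat \<times> nat \<Rightarrow> nat \<times> nat \<Rightarrow> bool" where
  "lex_less (a, b) (c, d) \<longleftrightarrow> a < c \<or> a = c \<and> b < d"

text \<open>Labels are sorted lists, so that equal sets of terms yield equal lists, from which a
  function defined by pattern matching can recover the cell.\<close>

lemma lex_sorted_unique:
  "sorted_wrt lex_less xs \<Longrightarrow> sorted_wrt lex_less ys \<Longrightarrow> set xs = set ys \<Longrightarrow> xs = ys"
proof (induction xs arbitrary: ys)
  case (Cons x xs)
  then obtain y ys' where ys: "ys = y # ys'" by (cases ys) auto
  have irrefl: "\<not> lex_less z z" for z by (cases z) auto
  have asym: "lex_less u w \<Longrightarrow> \<not> lex_less w u" for u w by (cases u; cases w) auto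
  have "x = y"
  proof (rule ccontr)
    assume "x \<noteq> y"
    with Cons.prems ys have "x \<in> set ys'" "y \<in> set xs" by auto
    then have "lex_less y x" "lex_less x y" using Cons.prems ys by auto
    with asym show False by blast
  qed
  moreover have "x \<notin> set xs" "y \<notin> set ys'" using Cons.prems(1,2) irrefl unfolding ys sorted_wrt.simps by blast+
  ultimately have "set xs = set ys'" using Cons.prems(3) ys by auto
  with Cons \<open>x = y\<close> ys show ?case by auto
qed simp

section \<open>The plane piece for degree at least three\<close>

text \<open>The piece of degree \<open>d = m + 3\<close> is the locus where the maximum of the terms \<open>i u - \<sigma> y + c (\<sigma>, i)\<close>,
\<open>(\<sigma>, i) \<in> M\<close>, is attained twice. It consists of \<open>m + 1\<close> floors: floor \<open>j\<close> separates the terms with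
\<open>\<sigma> = j + 2\<close> from those with \<open>\<sigma> = j + 3\<close> and has the vertices \<open>(j, t)\<close>, numbered from left to right by
\<open>t \<le> 2 j + 2\<close>. Its first and last vertex lie on the boundary of the region dominated by the term
\<open>(0, 0)\<close>; in between, odd vertices carry a vertical edge downwards and even ones an edge upwards.\<close>

locale floors = fixes m :: nat
begin

definition V :: "(nat \<times> nat) set" where "V = {(j, t). j \<le> m \<and> t \<le> 2 * j + 2}"

text \<open>The edge from (0, 0) to (0, 2) closes the top floor from above. The edges to floor
  \<open>j + 1\<close> are the left and right boundary of the region of the term (0, 0), and the
  vertical edges at odd positions.\<close>

definition E :: "((nat \<times> nat) \<times> nat \<times> nat) set" where
  "E = {((j, t), j', t'). j \<le> m \<and> t \<le> 2 * j + 2 \<and>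
     (j' = j \<and> t < 2 * j + 2 \<and> t' = t + 1 \<or>
      j = 0 \<and> t = 0 \<and> j' = 0 \<and> t' = 2 \<or>
      j < m \<and> j' = j + 1 \<and> (t = 0 \<and> t' = 0 \<or> t = 2 * j + 2 \<and> t' = 2 * j + 4 \<or> odd t \<and> t' = t + 1))}"

definition F :: "(nat \<times> nat) set" where "F = {(j, t). j = m \<and> t \<le> 2 * m + 2 \<and> odd t}"

text \<open>Lattice lengths of the dual bottom segments. For \<open>m = 0\<close> there is a single
  segment of length 3, to which both extra summands apply.\<close>

definition wF :: "nat \<times> nat \<Rightarrow> nat" where
  "wF v = 1 + (if snd v = 1 then 1 else 0) + (if snd v = 2 * m + 1 then 1 else 0)"

text \<open>The positions, here and in \<open>py\<close>, solve the equations that equate the three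
  terms in \<open>vlabel\<close>.\<close>

definition px :: "nat \<times> nat \<Rightarrow> int" where
  "px = (\<lambda>(j, t). if t = 0 then - ((int j + 2) * (int j + 3))
     else if t = 2 * j + 2 then (int j + 2) * (int j + 3) else int t - int j - 1)"

text \<open>The last floor hangs lower by \<open>(m + 2)\<^sup>2 + 2\<close>, the amount by which
  \<open>c\<close> falls below \<open>cc\<close> at the exponents of the bottom row other than the
  two corners.\<close>

definition py :: "nat \<times> nat \<Rightarrow> int" where
  "py = (\<lambda>(j, t). 2 * (int m - int j) +
     (if t = 0 then 0 else if t = 2 * j + 2 then (int j + 2) * (int j + 3)
      else int (t div 2) - (if j = m then (int m + 2) * (int m + 2) + 2 else 0)))"

text \<open>The two exceptions are the outer edges of the last floor, where a corner of the triangle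
  takes the place of an omitted exponent.\<close>

definition slope :: "nat \<Rightarrow> nat \<Rightarrow> int" where
  "slope j t = (if j = m \<and> t = 0 then - 1 else if j = m \<and> t = 2 * m + 1 then 2 else int (t mod 2))"

definition dx :: "nat \<times> nat \<Rightarrow> nat \<times> nat \<Rightarrow> int" where
  "dx = (\<lambda>(j, t) (j', t'). if j' = j then (if t' = t + 1 then 1 else 2)
     else if t = 0 then - (int j + 3) else if t = 2 * j + 2 then int j + 3 else 0)"

definition dy :: "nat \<times> nat \<Rightarrow> nat \<times> nat \<Rightarrow> int" where
  "dy = (\<lambda>(j, t) (j', t'). if j' = j then (if t' = t + 1 then slope j t else 1)
     else if t = 2 * j + 2 then int j + 2 else - 1)"

abbreviation "lv \<equiv> (m, 0::nat)"
abbreviation "rv \<equiv> (m, 2 * m + 2)"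
abbreviation "aa \<equiv> (int m + 2) * (int m + 3)"

lemma vertex_cases:
  assumes "v \<in> V"
  obtains (left) j where "v = (j, 0)" "j \<le> m"
    | (right) j where "v = (j, 2 * j + 2)" "j \<le> m"
    | (odd) j k where "v = (j, 2 * k + 1)" "k \<le> j" "j \<le> m"
    | (even) j k where "v = (j, 2 * k)" "1 \<le> k" "k \<le> j" "j \<le> m"
proof -
  obtain j t where v: "v = (j, t)" "j \<le> m" "t \<le> 2 * j + 2" using assms by (auto simp: V_def)
  consider "t = 0" | "t = 2 * j + 2" | k where "t = 2 * k + 1" | k where "t = 2 * k" "t \<noteq> 0" "t \<noteq> 2 * j + 2"
    by (metis evenE oddE)
  then show ?thesis
  proof cases
    case 1 with v left show ?thesis by auto
  next
    case 2 with v right show ?thesis by auto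
  next
    case (3 k) with v odd[of j k] show ?thesis by auto
  next
    case (4 k) with v even[of j k] show ?thesis by auto
  qed
qed

lemma edge_cases:
  assumes "(v, w) \<in> E"
  obtains (first) j where "v = (j, 0)" "w = (j, 1)" "j \<le> m"
    | (last) j where "v = (j, 2 * j + 1)" "w = (j, 2 * j + 2)" "j \<le> m"
    | (flat) j k where "v = (j, 2 * k)" "w = (j, 2 * k + 1)" "1 \<le> k" "k \<le> j" "j \<le> m"
    | (steep) j k where "v = (j, 2 * k + 1)" "w = (j, 2 * k + 2)" "k < j" "j \<le> m"
    | (top) "v = (0, 0)" "w = (0, 2)"
    | (lside) j where "v = (j, 0)" "w = (j + 1, 0)" "j < m"
    | (rside) j where "v = (j, 2 * j + 2)" "w = (j + 1, 2 * j + 4)" "j < m"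
    | (elev) j k where "v = (j, 2 * k + 1)" "w = (j + 1, 2 * k + 2)" "k \<le> j" "j < m"
proof -
  obtain j t j' t' where vw: "v = (j, t)" "w = (j', t')" "j \<le> m" "t \<le> 2 * j + 2"
    and c: "j' = j \<and> t < 2 * j + 2 \<and> t' = t + 1 \<or>
      j = 0 \<and> t = 0 \<and> j' = 0 \<and> t' = 2 \<or>
      j < m \<and> j' = j + 1 \<and> (t = 0 \<and> t' = 0 \<or> t = 2 * j + 2 \<and> t' = 2 * j + 4 \<or> odd t \<and> t' = t + 1)"
    using assms by (auto simp: E_def)
  from c consider "j' = j" "t < 2 * j + 2" "t' = t + 1" | "j = 0" "t = 0" "j' = 0" "t' = 2"
    | "j < m" "j' = j + 1" "t = 0" "t' = 0" | "j < m" "j' = j + 1" "t = 2 * j + 2" "t' = 2 * j + 4"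
    | "j < m" "j' = j + 1" "odd t" "t' = t + 1" by blast
  then show ?thesis
  proof cases
    case 1
    consider "t = 0" | "t = 2 * j + 1" | k where "t = 2 * k" "1 \<le> k" | k where "t = 2 * k + 1" "t \<noteq> 2 * j + 1"
    proof (cases "even t")
      case True
      then obtain k where "t = 2 * k" by (rule evenE)
      then show ?thesis using that(1) that(3)[of k] by (cases "k = 0") auto
    next
      case False
      then obtain k where "t = 2 * k + 1" by (rule oddE)
      then show ?thesis using that(2) that(4)[of k] by blast
    qed
    then show ?thesis
    proof cases
      case 1 with \<open>j' = j\<close> \<open>t' = t + 1\<close> vw first show ?thesis by auto
    next
      case 2 with \<open>j' = j\<close> \<open>t' = t + 1\<close> vw last show ?thesis by auto
    next
      case (3 k) with 1 vw flat[of j k] show ?thesis by auto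
    next
      case (4 k) with 1 vw steep[of j k] show ?thesis by auto
    qed
  next
    case 2 with vw top show ?thesis by auto
  next
    case 3 with vw lside[of j] show ?thesis by auto
  next
    case 4 with vw rside[of j] show ?thesis by auto
  next
    case 5
    then obtain k where "t = 2 * k + 1" by (auto elim: oddE)
    with 5 vw elev[of j k] show ?thesis by auto
  qed
qed

lemma px_simps [simp]:
  "px (j, 0) = - ((int j + 2) * (int j + 3))"
  "px (j, 2 * j + 2) = (int j + 2) * (int j + 3)"
  "px (j, 2 * k + 1) = 2 * int k - int j"
  "1 \<le> k \<Longrightarrow> k \<le> j \<Longrightarrow> px (j, 2 * k) = 2 * int k - int j - 1"
  unfolding px_def prod.case by presburger+

lemma py_simps [simp]:
  "py (j, 0) = 2 * (int m - int j)"
  "py (j, 2 * j + 2) = 2 * (int m - int j) + (int j + 2) * (int j + 3)"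
  "py (j, 2 * k + 1) = 2 * (int m - int j) + int k - (if j = m then (int m + 2) * (int m + 2) + 2 else 0)"
  "1 \<le> k \<Longrightarrow> k \<le> j \<Longrightarrow> py (j, 2 * k) = 2 * (int m - int j) + int k - (if j = m then (int m + 2) * (int m + 2) + 2 else 0)"
proof -
  have "2 * k + 1 \<noteq> 2 * j + 2" by presburger
  then show "py (j, 2 * k + 1) = 2 * (int m - int j) + int k - (if j = m then (int m + 2) * (int m + 2) + 2 else 0)"
    by (simp add: py_def)
qed (simp_all add: py_def)

text \<open>On the interior lattice points \<open>c\<close> is the quadratic function \<open>cc\<close>, whose induced subdivision is the
standard honeycomb; at the other monomials \<open>c\<close> is strictly smaller. In the bottom row \<open>\<sigma> = m + 3\<close> the
exponents 1 and \<open>m + 2\<close> are omitted, so that the first and the last downward ray have larger weight.\<close>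

definition cc :: "nat \<Rightarrow> nat \<Rightarrow> int" where
  "cc \<sigma> i = - int i * int i + int \<sigma> * int i - int \<sigma> * int \<sigma> + 2 * (int m + 2) * int \<sigma> + 1"

definition c :: "nat \<times> nat \<Rightarrow> int" where
  "c = (\<lambda>(\<sigma>, i). if \<sigma> = 0 then 0 else if \<sigma> \<le> m + 2 then cc \<sigma> i
     else if i = 0 \<or> i = m + 3 then 0 else - int i * int i + (int m + 3) * int i - 2)"

definition M :: "(nat \<times> nat) set" where
  "M = {(0, 0)} \<union> {(\<sigma>, i). 2 \<le> \<sigma> \<and> \<sigma> \<le> m + 2 \<and> 1 \<le> i \<and> i < \<sigma>}
     \<union> {(\<sigma>, i). \<sigma> = m + 3 \<and> (i = 0 \<or> i = m + 3 \<or> 2 \<le> i \<and> i \<le> m + 1)}"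

definition ival :: "nat \<times> nat \<Rightarrow> nat \<times> nat \<Rightarrow> int" where
  "ival \<mu> v = int (snd \<mu>) * px v - int (fst \<mu>) * py v + c \<mu>"

text \<open>The terms attaining the maximum at a vertex, in lexicographic order.\<close>

definition vlabel :: "nat \<times> nat \<Rightarrow> (nat \<times> nat) list" where
  "vlabel = (\<lambda>(j, t).
     if t = 0 then [(0, 0), (j + 2, 1), (j + 3, if j = m then 0 else 1)]
     else if t = 2 * j + 2 then [(0, 0), (j + 2, j + 1), (j + 3, if j = m then j + 3 else j + 2)]
     else if odd t then [(j + 2, t div 2 + 1), (j + 3, if j = m \<and> t = 1 then 0 else t div 2 + 1),
        (j + 3, if j = m \<and> t = 2 * m + 1 then m + 3 else t div 2 + 2)]
     else [(j + 2, t div 2), (j + 2, t div 2 + 1), (j + 3, t div 2 + 1)])"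

lemma vlabel_simps [simp]:
  "vlabel (j, 0) = [(0, 0), (j + 2, 1), (j + 3, if j = m then 0 else 1)]"
  "vlabel (j, 2 * j + 2) = [(0, 0), (j + 2, j + 1), (j + 3, if j = m then j + 3 else j + 2)]"
  "vlabel (j, 2 * k + 1) = [(j + 2, k + 1), (j + 3, if j = m \<and> k = 0 then 0 else k + 1),
        (j + 3, if j = m \<and> k = m then m + 3 else k + 2)]"
  "1 \<le> k \<Longrightarrow> k \<le> j \<Longrightarrow> vlabel (j, 2 * k) = [(j + 2, k), (j + 2, k + 1), (j + 3, k + 1)]"
proof -
  have "2 * k + 1 \<noteq> 2 * j + 2" by presburger
  then show "vlabel (j, 2 * k + 1) = [(j + 2, k + 1), (j + 3, if j = m \<and> k = 0 then 0 else k + 1),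
        (j + 3, if j = m \<and> k = m then m + 3 else k + 2)]"
    by (simp add: vlabel_def)
qed (simp_all add: vlabel_def)

lemma M_cases:
  assumes "\<mu> \<in> M"
  obtains (zero) "\<mu> = (0, 0)"
    | (inner) \<sigma> i where "\<mu> = (\<sigma>, i)" "2 \<le> \<sigma>" "\<sigma> \<le> m + 2" "1 \<le> i" "i < \<sigma>"
    | (corner0) "\<mu> = (m + 3, 0)" | (corner1) "\<mu> = (m + 3, m + 3)"
    | (bottom) i where "\<mu> = (m + 3, i)" "2 \<le> i" "i \<le> m + 1"
  using assms by (auto simp: M_def)

lemma c_simps [simp]:
  "c (0, i) = 0" "1 \<le> \<sigma> \<Longrightarrow> \<sigma> \<le> m + 2 \<Longrightarrow> c (\<sigma>, i) = cc \<sigma> i"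
  "c (m + 3, 0) = 0" "c (m + 3, m + 3) = 0"
  "2 \<le> i \<Longrightarrow> i \<le> m + 1 \<Longrightarrow> c (m + 3, i) = - int i * int i + (int m + 3) * int i - 2"
  by (simp_all add: c_def)

text \<open>Proofs of maximality may replace \<open>c\<close> by \<open>cc\<close> and treat the
  difference as an additional loss, which vanishes exactly at the interior lattice points. The
  summand 1 in \<open>cc\<close> makes the loss positive at (0, 0).\<close>

lemma c_le_cc:
  assumes "(\<sigma>, i) \<in> M"
  shows "c (\<sigma>, i) \<le> cc \<sigma> i" "c (\<sigma>, i) = cc \<sigma> i \<longleftrightarrow> 2 \<le> \<sigma> \<and> \<sigma> \<le> m + 2"
proof -
  have "c (\<sigma>, i) < cc \<sigma> i" if "\<not> (2 \<le> \<sigma> \<and> \<sigma> \<le> m + 2)"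
    using assms
  proof (cases rule: M_cases)
    case (bottom i')
    then have "cc \<sigma> i - c (\<sigma>, i) = (int m + 2) * (int m + 2) + 2"
      by (simp add: cc_def algebra_simps)
    then show ?thesis using zero_le_square[of "int m + 2"] by linarith
  qed (use that in \<open>auto simp: cc_def algebra_simps intro!: add_pos_nonneg\<close>)
  moreover have "c (\<sigma>, i) = cc \<sigma> i" if "2 \<le> \<sigma> \<and> \<sigma> \<le> m + 2" using that by simp
  ultimately show "c (\<sigma>, i) \<le> cc \<sigma> i" "c (\<sigma>, i) = cc \<sigma> i \<longleftrightarrow> 2 \<le> \<sigma> \<and> \<sigma> \<le> m + 2"
    by force+
qed

definition hexf :: "int \<Rightarrow> int \<Rightarrow> int" where "hexf x z = x * x - x * z + z * z - z"

lemma hexf_nonneg: "hexf x z \<ge> 0"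
  and hexf_zero: "hexf x z = 0 \<longleftrightarrow> x = 0 \<and> z = 0 \<or> x = 0 \<and> z = 1 \<or> x = 1 \<and> z = 1"
  unfolding hexf_def by (fact hex_form_nonneg)+

definition maximal_at :: "nat \<times> nat \<Rightarrow> bool" where
  "maximal_at v \<longleftrightarrow> (\<exists>T. \<forall>\<mu>\<in>M. ival \<mu> v \<le> T \<and> (ival \<mu> v = T \<longleftrightarrow> \<mu> \<in> set (vlabel v)))"

lemma maximal_atI:
  "(\<And>\<sigma> i. (\<sigma>, i) \<in> M \<Longrightarrow> ival (\<sigma>, i) v \<le> T \<and> (ival (\<sigma>, i) v = T \<longleftrightarrow> (\<sigma>, i) \<in> set (vlabel v)))
    \<Longrightarrow> maximal_at v"
  unfolding maximal_at_def by (rule exI[of _ T]) auto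

lemma slack_zero:
  fixes v T h w e :: int
  assumes "v = T - h + w - e" "h \<ge> 0" "w \<le> 0" "e \<ge> 0"
  shows "v \<le> T \<and> (v = T \<longleftrightarrow> h = 0 \<and> w = 0 \<and> e = 0)"
  using assms by auto

section \<open>The maximal terms at every vertex\<close>

lemma maximal_inner_odd:
  assumes "k \<le> j" "j < m" shows "maximal_at (j, 2 * k + 1)"
proof -
  define T where "T = (int k + 1) * (int k + 1) + (int j + 2) * (int j + 2) - (int j + 2) * (int k + 1) + int j + 3"
  have "ival (\<sigma>, i) (j, 2 * k + 1) \<le> T \<and> (ival (\<sigma>, i) (j, 2 * k + 1) = T \<longleftrightarrow> (\<sigma>, i) \<in> set (vlabel (j, 2 * k + 1)))"
    if "(\<sigma>, i) \<in> M" for \<sigma> i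
  proof -
    define x z where "x = int i - (int k + 1)" and "z = int \<sigma> - (int j + 2)"
    \<comment> \<open>The deficit is the hexagonal form centred at the first entry of the label; its
      zeros are the label. Even vertices use the form with its arguments swapped, for the triangles
      of the other orientation.\<close>
    have "ival (\<sigma>, i) (j, 2 * k + 1) = T - hexf x z - (cc \<sigma> i - c (\<sigma>, i))"
      using assms unfolding ival_def px_simps py_simps
      by (simp add: T_def cc_def hexf_def x_def z_def algebra_simps)
    moreover have "hexf x z = 0 \<longleftrightarrow> (\<sigma>, i) \<in> set (vlabel (j, 2 * k + 1))"
      using assms unfolding hexf_zero x_def z_def vlabel_simps by auto
    moreover have "(\<sigma>, i) \<in> set (vlabel (j, 2 * k + 1)) \<Longrightarrow> c (\<sigma>, i) = cc \<sigma> i"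
      using assms unfolding vlabel_simps by auto
    ultimately show ?thesis using c_le_cc[OF that] hexf_nonneg[of x z] by linarith
  qed
  then show ?thesis by (rule maximal_atI)
qed

lemma maximal_inner_even:
  assumes "1 \<le> k" "k \<le> j" "j < m" shows "maximal_at (j, 2 * k)"
proof -
  define T where "T = int k * int k + (int j + 2) * (int j + 2) - (int j + 2) * int k + int k + 1"
  have "ival (\<sigma>, i) (j, 2 * k) \<le> T \<and> (ival (\<sigma>, i) (j, 2 * k) = T \<longleftrightarrow> (\<sigma>, i) \<in> set (vlabel (j, 2 * k)))"
    if "(\<sigma>, i) \<in> M" for \<sigma> i
  proof -
    define x z where "x = int i - int k" and "z = int \<sigma> - (int j + 2)"
    have "ival (\<sigma>, i) (j, 2 * k) = T - hexf z x - (cc \<sigma> i - c (\<sigma>, i))"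
      using assms unfolding ival_def px_simps(4)[OF assms(1,2)] py_simps(4)[OF assms(1,2)]
      by (simp add: T_def cc_def hexf_def x_def z_def algebra_simps)
    moreover have "hexf z x = 0 \<longleftrightarrow> (\<sigma>, i) \<in> set (vlabel (j, 2 * k))"
      using assms unfolding hexf_zero x_def z_def vlabel_simps(4)[OF assms(1,2)] by auto
    moreover have "(\<sigma>, i) \<in> set (vlabel (j, 2 * k)) \<Longrightarrow> c (\<sigma>, i) = cc \<sigma> i"
      using assms unfolding vlabel_simps(4)[OF assms(1,2)] by auto
    ultimately show ?thesis using c_le_cc[OF that] hexf_nonneg[of z x] by linarith
  qed
  then show ?thesis by (rule maximal_atI)
qed

text \<open>The value of the \<open>cc\<close> term at the left vertex of a floor, with
  \<open>s = j + 2\<close> and \<open>\<delta> = m - j\<close>. Apart from the hexagonal form, each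
  step of the exponent away from 1 costs \<open>s * s + 2\<close>, so only exponent 1 can tie with
  the term (0, 0).\<close>

lemma boundary_value:
  fixes i \<sigma> s \<delta> :: int
  assumes "i \<ge> 1"
  defines "v \<equiv> - i * (s * (s + 1)) - 2 * \<sigma> * \<delta> - i * i + \<sigma> * i - \<sigma> * \<sigma> + 2 * (s + \<delta>) * \<sigma> + 1"
  shows "v \<le> 0" "v = 0 \<longleftrightarrow> i = 1 \<and> (\<sigma> = s \<or> \<sigma> = s + 1)"
proof -
  define x z where "x = i - 1" and "z = \<sigma> - s"
  have v: "v = - hexf x z - x * (s * s + 2)"
    by (simp add: v_def hexf_def x_def z_def algebra_simps)
  have "x * (s * s + 2) \<ge> 0" using assms(1) by (auto simp: x_def intro!: mult_nonneg_nonneg)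
  moreover have "s * s + 2 > 0" using zero_le_square[of s] by linarith
  then have "x * (s * s + 2) = 0 \<longleftrightarrow> x = 0" by auto
  moreover have "hexf 0 z = 0 \<longleftrightarrow> z = 0 \<or> z = 1" by (auto simp: hexf_zero)
  ultimately have "v \<le> 0" "v = 0 \<longleftrightarrow> x = 0 \<and> (z = 0 \<or> z = 1)"
    unfolding v using hexf_nonneg[of x z] by (linarith, smt (verit))
  then show "v \<le> 0" "v = 0 \<longleftrightarrow> i = 1 \<and> (\<sigma> = s \<or> \<sigma> = s + 1)"
    by (auto simp: x_def z_def)
qed

lemma maximal_left:
  assumes "j \<le> m" shows "maximal_at (j, 0)"
proof -
  have "ival \<mu> (j, 0) \<le> 0 \<and> (ival \<mu> (j, 0) = 0 \<longleftrightarrow> \<mu> \<in> set (vlabel (j, 0)))" if "\<mu> \<in> M" for \<mu>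
  proof (cases "snd \<mu> = 0")
    case True
    with that have "\<mu> = (0, 0) \<or> \<mu> = (m + 3, 0)" by (cases rule: M_cases) auto
    moreover have "ival (m + 3, 0) (j, 0) = - ((int m + 3) * (2 * (int m - int j)))"
      by (simp add: ival_def)
    moreover have "(int m + 3) * (2 * (int m - int j)) \<ge> 0" using assms by simp
    moreover have "(int m + 3) * (2 * (int m - int j)) = 0 \<longleftrightarrow> j = m" by auto
    moreover have "(m + 3, 0) \<in> set (vlabel (j, 0)) \<longleftrightarrow> j = m" by simp
    moreover have "ival (0, 0) (j, 0) = 0" "(0, 0) \<in> set (vlabel (j, 0))" by (simp_all add: ival_def)
    ultimately show ?thesis by (metis neg_le_0_iff_le neg_equal_0_iff_equal order_refl)
  next
    case False
    obtain \<sigma> i where \<mu>: "\<mu> = (\<sigma>, i)" by (cases \<mu>)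
    note b = boundary_value[of "int i" "int j + 2" "int \<sigma>" "int m - int j"]
    define w where "w = - int i * ((int j + 2) * (int j + 2 + 1)) - 2 * int \<sigma> * (int m - int j) - int i * int i
      + int \<sigma> * int i - int \<sigma> * int \<sigma> + 2 * (int j + 2 + (int m - int j)) * int \<sigma> + 1"
    have "w \<le> 0" "w = 0 \<longleftrightarrow> i = 1 \<and> (\<sigma> = j + 2 \<or> \<sigma> = j + 3)"
      using b False unfolding w_def \<mu> by auto
    moreover have "ival (\<sigma>, i) (j, 0) = w - (cc \<sigma> i - c (\<sigma>, i))"
      by (simp add: ival_def w_def cc_def algebra_simps)
    moreover have "\<mu> \<in> set (vlabel (j, 0)) \<longleftrightarrow> i = 1 \<and> (\<sigma> = j + 2 \<or> \<sigma> = j + 3 \<and> j \<noteq> m)"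
      using False by (auto simp: \<mu>)
    moreover have "2 \<le> \<sigma> \<and> \<sigma> \<le> m + 2 \<and> (\<sigma> = j + 2 \<or> \<sigma> = j + 3) \<longleftrightarrow> \<sigma> = j + 2 \<or> \<sigma> = j + 3 \<and> j \<noteq> m"
      using assms by linarith
    moreover note c_le_cc[OF that[unfolded \<mu>]]
    ultimately show ?thesis unfolding \<mu> by (smt (verit))
  qed
  then show ?thesis unfolding maximal_at_def by blast
qed

text \<open>Replacing \<open>i\<close> by \<open>\<sigma> - i\<close> corresponds to the lattice
  reflection that sends (u, y) to (-u, y - u). It exchanges the two sides and spares a second
  computation for the right vertices.\<close>

lemma ival_reflect:
  assumes "(\<sigma>, i) \<in> M"
  shows "(\<sigma>, \<sigma> - i) \<in> M" "i \<le> \<sigma>" "ival (\<sigma>, i) (j, 2 * j + 2) = ival (\<sigma>, \<sigma> - i) (j, 0)"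
proof -
  show le: "i \<le> \<sigma>" using assms by (auto simp: M_def)
  show "(\<sigma>, \<sigma> - i) \<in> M" using assms by (auto simp: M_def)
  have "c (\<sigma>, i) = c (\<sigma>, \<sigma> - i)"
    using assms le by (auto simp: M_def c_def cc_def of_nat_diff algebra_simps)
  then show "ival (\<sigma>, i) (j, 2 * j + 2) = ival (\<sigma>, \<sigma> - i) (j, 0)"
    unfolding ival_def px_simps py_simps using le by (simp add: of_nat_diff algebra_simps)
qed

lemma maximal_right:
  assumes "j \<le> m" shows "maximal_at (j, 2 * j + 2)"
proof -
  obtain T where T: "\<And>\<mu>. \<mu> \<in> M \<Longrightarrow> ival \<mu> (j, 0) \<le> T \<and> (ival \<mu> (j, 0) = T \<longleftrightarrow> \<mu> \<in> set (vlabel (j, 0)))"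
    using maximal_left[OF assms] unfolding maximal_at_def by blast
  have "ival (\<sigma>, i) (j, 2 * j + 2) \<le> T \<and>
    (ival (\<sigma>, i) (j, 2 * j + 2) = T \<longleftrightarrow> (\<sigma>, i) \<in> set (vlabel (j, 2 * j + 2)))" if "(\<sigma>, i) \<in> M" for \<sigma> i
  proof -
    have "(\<sigma>, \<sigma> - i) \<in> set (vlabel (j, 0)) \<longleftrightarrow> (\<sigma>, i) \<in> set (vlabel (j, 2 * j + 2))"
      unfolding vlabel_simps using ival_reflect(2)[OF that] by auto
    then show ?thesis using T[OF ival_reflect(1)[OF that]] ival_reflect(3)[OF that] by simp
  qed
  then show ?thesis by (rule maximal_atI)
qed

text \<open>As the last floor lies lower by \<open>S * S + 2\<close>, each row above row
  \<open>m + 2\<close> falls behind by a further \<open>S * S + 2\<close>, and the bottom row just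
  makes up for its smaller \<open>c\<close>. The corners lie only \<open>S * S\<close> below
  \<open>cc\<close>; the two units gained let them tie at the first and the last odd vertex.\<close>

lemma maximal_last_odd:
  assumes "k \<le> m" shows "maximal_at (m, 2 * k + 1)"
proof -
  define S where "S = int m + 2"
  define T where "T = (S + 1) * (S * S + 2 - int k) - 2 + (int k + 1) * (int k + 2)"
  have "ival \<mu> (m, 2 * k + 1) \<le> T \<and> (ival \<mu> (m, 2 * k + 1) = T \<longleftrightarrow> \<mu> \<in> set (vlabel (m, 2 * k + 1)))"
    if "\<mu> \<in> M" for \<mu>
  proof (cases "fst \<mu> \<le> m + 2")
    case True
    obtain \<sigma> i where \<mu>: "\<mu> = (\<sigma>, i)" by (cases \<mu>)
    define x z where "x = int i - (int k + 1)" and "z = int \<sigma> - S"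
    have "ival (\<sigma>, i) (m, 2 * k + 1) = T - hexf x z + z * (S * S + 2) - (cc \<sigma> i - c (\<sigma>, i))"
      unfolding ival_def px_simps py_simps
      by (simp add: T_def cc_def hexf_def x_def z_def S_def algebra_simps)
    moreover have "z \<le> 0" using True by (simp add: z_def S_def \<mu>)
    moreover have pos: "S * S + 2 > 0" using zero_le_square[of S] by linarith
    with \<open>z \<le> 0\<close> have "z * (S * S + 2) \<le> 0" by (intro mult_nonpos_nonneg) auto
    moreover note hexf_nonneg
    moreover have "cc \<sigma> i - c (\<sigma>, i) \<ge> 0" using c_le_cc[OF that[unfolded \<mu>]] by simp
    ultimately have "ival \<mu> (m, 2 * k + 1) \<le> T \<and> (ival \<mu> (m, 2 * k + 1) = T \<longleftrightarrow>
        hexf x z = 0 \<and> z * (S * S + 2) = 0 \<and> cc \<sigma> i - c (\<sigma>, i) = 0)"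
      unfolding \<mu> by (intro slack_zero) auto
    moreover have "z * (S * S + 2) = 0 \<longleftrightarrow> z = 0" using pos by auto
    moreover have "hexf x 0 = 0 \<longleftrightarrow> x = 0" by (auto simp: hexf_zero)
    moreover have "\<mu> \<in> set (vlabel (m, 2 * k + 1)) \<longleftrightarrow> x = 0 \<and> z = 0"
      using True unfolding vlabel_simps \<mu> x_def z_def S_def by auto
    moreover have "z = 0 \<Longrightarrow> c (\<sigma>, i) = cc \<sigma> i" using True by (simp add: z_def S_def \<mu>)
    ultimately show ?thesis by auto
  next
    case False
    from that show ?thesis
    proof (cases rule: M_cases)
      case corner0
      have "ival \<mu> (m, 2 * k + 1) = T - int k * (int k + 3)"
        unfolding ival_def corner0 px_simps py_simps by (simp add: T_def S_def algebra_simps)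
      then show ?thesis unfolding corner0 vlabel_simps by auto
    next
      case corner1
      have "ival \<mu> (m, 2 * k + 1) = T - (int m - int k) * (int m - int k + 3)"
        unfolding ival_def corner1 px_simps py_simps by (simp add: T_def S_def algebra_simps)
      then show ?thesis using assms unfolding corner1 vlabel_simps by auto
    next
      case (bottom i)
      have "ival \<mu> (m, 2 * k + 1) = T - (int i - int k - 1) * (int i - int k - 2)"
        unfolding ival_def bottom(1) px_simps py_simps using bottom by (simp add: T_def S_def algebra_simps)
      moreover have "(int i - int k - 1) * (int i - int k - 2) \<ge> 0"
        by (cases "i \<le> k + 1") (auto intro: mult_nonpos_nonpos)
      moreover have "(int i - int k - 1) * (int i - int k - 2) = 0 \<longleftrightarrow> i = k + 1 \<or> i = k + 2"
        by auto
      ultimately show ?thesis using bottom assms unfolding bottom(1) vlabel_simps by auto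
    qed (use False in auto)
  qed
  then show ?thesis unfolding maximal_at_def by blast
qed

lemma maximal_last_even:
  assumes "1 \<le> k" "k \<le> m" shows "maximal_at (m, 2 * k)"
proof -
  define S where "S = int m + 2"
  define T where "T = (S + 1) * (S * S + 2 - int k) - 2 + (int k + 1) * (int k + 1)"
  have "ival \<mu> (m, 2 * k) \<le> T \<and> (ival \<mu> (m, 2 * k) = T \<longleftrightarrow> \<mu> \<in> set (vlabel (m, 2 * k)))"
    if "\<mu> \<in> M" for \<mu>
  proof (cases "fst \<mu> \<le> m + 2")
    case True
    obtain \<sigma> i where \<mu>: "\<mu> = (\<sigma>, i)" by (cases \<mu>)
    define x z where "x = int i - int k" and "z = int \<sigma> - S"
    have "ival (\<sigma>, i) (m, 2 * k) = T - hexf z x + z * (S * S + 2) - (cc \<sigma> i - c (\<sigma>, i))"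
      unfolding ival_def px_simps(4)[OF assms] py_simps(4)[OF assms]
      by (simp add: T_def cc_def hexf_def x_def z_def S_def algebra_simps)
    moreover have "z \<le> 0" using True by (simp add: z_def S_def \<mu>)
    moreover have pos: "S * S + 2 > 0" using zero_le_square[of S] by linarith
    with \<open>z \<le> 0\<close> have "z * (S * S + 2) \<le> 0" by (intro mult_nonpos_nonneg) auto
    moreover note hexf_nonneg
    moreover have "cc \<sigma> i - c (\<sigma>, i) \<ge> 0" using c_le_cc[OF that[unfolded \<mu>]] by simp
    ultimately have "ival \<mu> (m, 2 * k) \<le> T \<and> (ival \<mu> (m, 2 * k) = T \<longleftrightarrow>
        hexf z x = 0 \<and> z * (S * S + 2) = 0 \<and> cc \<sigma> i - c (\<sigma>, i) = 0)"
      unfolding \<mu> by (intro slack_zero) auto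
    moreover have "z * (S * S + 2) = 0 \<longleftrightarrow> z = 0" using pos by auto
    moreover have "hexf 0 x = 0 \<longleftrightarrow> x = 0 \<or> x = 1" by (auto simp: hexf_zero)
    moreover have "\<mu> \<in> set (vlabel (m, 2 * k)) \<longleftrightarrow> (x = 0 \<or> x = 1) \<and> z = 0"
      using True unfolding vlabel_simps(4)[OF assms] \<mu> x_def z_def S_def by auto
    moreover have "z = 0 \<Longrightarrow> c (\<sigma>, i) = cc \<sigma> i" using True by (simp add: z_def S_def \<mu>)
    ultimately show ?thesis by auto
  next
    case False
    from that show ?thesis
    proof (cases rule: M_cases)
      case corner0
      have "ival \<mu> (m, 2 * k) = T - ((int k + 1) * (int k + 1) - 2)"
        unfolding ival_def corner0 px_simps(4)[OF assms] py_simps(4)[OF assms] by (simp add: T_def S_def algebra_simps)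
      moreover have "(int k + 1) * (int k + 1) \<ge> 2 * 2" using assms by (intro mult_mono) auto
      ultimately show ?thesis unfolding corner0 vlabel_simps(4)[OF assms] by auto
    next
      case corner1
      have "ival \<mu> (m, 2 * k) = T - ((int m - int k + 2) * (int m - int k + 2) - 2)"
        unfolding ival_def corner1 px_simps(4)[OF assms] py_simps(4)[OF assms] by (simp add: T_def S_def algebra_simps)
      moreover have "(int m - int k + 2) * (int m - int k + 2) \<ge> 2 * 2" using assms by (intro mult_mono) auto
      ultimately show ?thesis using assms unfolding corner1 vlabel_simps(4)[OF assms] by auto
    next
      case (bottom i)
      have "ival \<mu> (m, 2 * k) = T - (int i - int k - 1) * (int i - int k - 1)"
        unfolding ival_def bottom(1) px_simps(4)[OF assms] py_simps(4)[OF assms] using bottom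
        by (simp add: T_def S_def algebra_simps)
      moreover have "(int i - int k - 1) * (int i - int k - 1) = 0 \<longleftrightarrow> i = k + 1"
        by auto
      ultimately show ?thesis using bottom zero_le_square[of "int i - int k - 1"]
        unfolding bottom(1) vlabel_simps(4)[OF assms] by auto
    qed (use False in auto)
  qed
  then show ?thesis unfolding maximal_at_def by blast
qed

lemma maximal_at_vertex:
  assumes "v \<in> V" shows "maximal_at v"
  using assms
proof (cases v rule: vertex_cases)
  case (odd j k) then show ?thesis
    using maximal_inner_odd[of k j] maximal_last_odd[of k] by (cases "j = m") auto
next
  case (even j k) then show ?thesis
    using maximal_inner_even[of k j] maximal_last_even[of k] by (cases "j = m") auto
qed (simp_all only: maximal_left maximal_right)

lemma vlabel_sub:
  assumes "v \<in> V" shows "set (vlabel v) \<subseteq> M"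
  using assms
proof (cases v rule: vertex_cases)
  case (left j)
  show ?thesis unfolding left(1) vlabel_simps using left(2) by (auto simp: M_def)
next
  case (right j)
  show ?thesis unfolding right(1) vlabel_simps using right(2) by (auto simp: M_def)
next
  case (odd j k)
  show ?thesis unfolding odd(1) vlabel_simps using odd(2,3) by (auto simp: M_def)
next
  case (even j k)
  show ?thesis unfolding even(1) vlabel_simps(4)[OF even(2,3)] using even(2-) by (auto simp: M_def)
qed

lemma dominant_vertex:
  assumes "v \<in> V"
  shows "dominant c M (of_int (px v), of_int (py v)) (set (vlabel v))"
proof -
  have val: "tval c \<mu> (of_int (px v), of_int (py v)) = of_int (ival \<mu> v)" for \<mu>
    by (simp add: tval_def ival_def)
  obtain T where "\<And>\<mu>. \<mu> \<in> M \<Longrightarrow> ival \<mu> v \<le> T \<and> (ival \<mu> v = T \<longleftrightarrow> \<mu> \<in> set (vlabel v))"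
    using maximal_at_vertex[OF assms] unfolding maximal_at_def by blast
  then have "\<forall>\<mu>\<in>M. of_int (ival \<mu> v) \<le> (of_int T :: real) \<and> (of_int (ival \<mu> v) = (of_int T :: real) \<longleftrightarrow> \<mu> \<in> set (vlabel v))"
    by simp
  moreover have "set (vlabel v) \<noteq> {}" by (cases v) (simp add: vlabel_def)
  ultimately show ?thesis
    unfolding dominant_def val using vlabel_sub[OF assms] by blast
qed

section \<open>Labels of edges, and the recovery of cells from labels\<close>

definition elabel :: "nat \<times> nat \<Rightarrow> nat \<times> nat \<Rightarrow> (nat \<times> nat) list" where
  "elabel v w = filter (\<lambda>\<mu>. \<mu> \<in> set (vlabel w)) (vlabel v)"

lemma vlabel_next [simp]:
  "k < j \<Longrightarrow> vlabel (j, 2 * k + 2) = [(j + 2, k + 1), (j + 2, k + 2), (j + 3, k + 2)]"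
  using vlabel_simps(4)[of "k + 1" j] by simp

lemma vlabel_Suc [simp]:
  "vlabel (j, Suc (Suc (2 * j))) = [(0, 0), (j + 2, j + 1), (j + 3, if j = m then j + 3 else j + 2)]"
  "vlabel (j, Suc (2 * k)) = [(j + 2, k + 1), (j + 3, if j = m \<and> k = 0 then 0 else k + 1),
        (j + 3, if j = m \<and> k = m then m + 3 else k + 2)]"
  "k < j \<Longrightarrow> vlabel (j, Suc (Suc (2 * k))) = [(j + 2, k + 1), (j + 2, k + 2), (j + 3, k + 2)]"
  using vlabel_simps(2)[of j] vlabel_simps(3)[of j k] vlabel_next[of k j]
  by (simp_all del: vlabel_simps vlabel_next)

lemma vlabel_right_Suc [simp]:
  "vlabel (Suc j, 2 * j + 4) = [(0, 0), (j + 3, j + 2), (j + 4, if j + 1 = m then j + 4 else j + 3)]"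
  by (simp add: vlabel_def)

lemma elabel_simps:
  "elabel (j, 0) (j, 1) = [(j + 2, 1), (j + 3, if j = m then 0 else 1)]"
  "elabel (j, 2 * j + 1) (j, 2 * j + 2) = [(j + 2, j + 1), (j + 3, if j = m then m + 3 else j + 2)]"
  "1 \<le> k \<Longrightarrow> k \<le> j \<Longrightarrow> elabel (j, 2 * k) (j, 2 * k + 1) = [(j + 2, k + 1), (j + 3, k + 1)]"
  "k < j \<Longrightarrow> elabel (j, 2 * k + 1) (j, 2 * k + 2) = [(j + 2, k + 1), (j + 3, k + 2)]"
  "elabel (0, 0) (0, 2) = [(0, 0), (2, 1)]"
  "j < m \<Longrightarrow> elabel (j, 0) (j + 1, 0) = [(0, 0), (j + 3, 1)]"
  "j < m \<Longrightarrow> elabel (j, 2 * j + 2) (j + 1, 2 * j + 4) = [(0, 0), (j + 3, j + 2)]"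
  "k \<le> j \<Longrightarrow> j < m \<Longrightarrow> elabel (j, 2 * k + 1) (j + 1, 2 * k + 2) = [(j + 3, k + 1), (j + 3, k + 2)]"
  subgoal using vlabel_simps(3)[of j 0] by (simp add: elabel_def)
  subgoal unfolding elabel_def vlabel_simps by simp
  subgoal unfolding elabel_def vlabel_simps(3) by simp
  subgoal unfolding elabel_def vlabel_simps(3) by simp
  subgoal by (simp add: elabel_def vlabel_def del: vlabel_simps vlabel_next vlabel_Suc)
  subgoal unfolding elabel_def vlabel_simps by simp
  subgoal unfolding elabel_def vlabel_simps by simp
  subgoal unfolding elabel_def vlabel_simps(3) by simp
  done

lemma edge_label_cases:
  assumes "(v, w) \<in> E"
  obtains (first) j where "v = (j, 0)" "w = (j, 1)" "elabel v w = [(j + 2, 1), (j + 3, if j = m then 0 else 1)]"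
    | (last) j where "v = (j, 2 * j + 1)" "w = (j, 2 * j + 2)"
        "elabel v w = [(j + 2, j + 1), (j + 3, if j = m then m + 3 else j + 2)]"
    | (flat) j k where "v = (j, 2 * k)" "w = (j, 2 * k + 1)" "1 \<le> k" "k \<le> j" "j \<le> m" "elabel v w = [(j + 2, k + 1), (j + 3, k + 1)]"
    | (steep) j k where "v = (j, 2 * k + 1)" "w = (j, 2 * k + 2)" "k < j" "j \<le> m" "elabel v w = [(j + 2, k + 1), (j + 3, k + 2)]"
    | (top) "v = (0, 0)" "w = (0, 2)" "elabel v w = [(0, 0), (2, 1)]"
    | (lside) j where "v = (j, 0)" "w = (j + 1, 0)" "j < m" "elabel v w = [(0, 0), (j + 3, 1)]"
    | (rside) j where "v = (j, 2 * j + 2)" "w = (j + 1, 2 * j + 4)" "j < m" "elabel v w = [(0, 0), (j + 3, j + 2)]"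
    | (elev) j k where "v = (j, 2 * k + 1)" "w = (j + 1, 2 * k + 2)" "k \<le> j" "j < m" "elabel v w = [(j + 3, k + 1), (j + 3, k + 2)]"
  using assms
proof (cases rule: edge_cases)
  case first then show ?thesis using that(1) elabel_simps(1) by blast
next
  case last then show ?thesis using that(2) elabel_simps(2) by blast
next
  case flat then show ?thesis using that(3) elabel_simps(3) by blast
next
  case steep then show ?thesis using that(4) elabel_simps(4) by blast
next
  case top then show ?thesis using that(5) elabel_simps(5) by blast
next
  case lside then show ?thesis using that(6) elabel_simps(6) by blast
next
  case rside then show ?thesis using that(7) elabel_simps(7) by blast
next
  case elev then show ?thesis using that(8) elabel_simps(8) by blast
qed

text \<open>A left inverse of \<open>elabel\<close>. The order of the tests matters: the outer edges
  of a floor are filtered out before the generic cases, since on the last floor their exponents are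
  irregular.\<close>

fun edge_of_label :: "(nat \<times> nat) list \<Rightarrow> (nat \<times> nat) \<times> nat \<times> nat" where
  "edge_of_label [(a, b), (a', b')] =
    (if a = 0 then if a' = 2 then ((0, 0), (0, 2))
       else if b' = 1 then ((a' - 3, 0), (a' - 2, 0))
       else ((a' - 3, 2 * (a' - 3) + 2), (a' - 2, 2 * (a' - 3) + 4))
     else if a = a' then ((a - 3, 2 * (b - 1) + 1), (a - 2, 2 * (b - 1) + 2))
     else if b' = 0 \<or> b = 1 \<and> b' = 1 then ((a - 2, 0), (a - 2, 1))
     else if b = a - 1 \<and> b' \<noteq> b then ((a - 2, 2 * (a - 2) + 1), (a - 2, 2 * (a - 2) + 2))
     else if b = b' then ((a - 2, 2 * (b - 1)), (a - 2, 2 * (b - 1) + 1))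
     else ((a - 2, 2 * (b - 1) + 1), (a - 2, 2 * (b - 1) + 2)))"
| "edge_of_label _ = undefined"

lemma elabel_inj:
  assumes "(v, w) \<in> E" "(v', w') \<in> E" "elabel v w = elabel v' w'"
  shows "(v, w) = (v', w')"
proof -
  have "edge_of_label (elabel v w) = (v, w)" if "(v, w) \<in> E" for v w
    using that by (cases rule: edge_label_cases) simp_all
  with assms show ?thesis by metis
qed

fun vertex_of_label :: "(nat \<times> nat) list \<Rightarrow> nat \<times> nat" where
  "vertex_of_label [(a, b), (a', b'), (a'', b'')] =
    (if a = 0 then (if b'' \<le> 1 then (a' - 2, 0) else (a' - 2, 2 * (a' - 2) + 2))
     else if a = a' then (a - 2, 2 * b) else (a - 2, 2 * (b - 1) + 1))"
| "vertex_of_label _ = undefined"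

lemma vlabel_inj:
  assumes "v \<in> V" "v' \<in> V" "vlabel v = vlabel v'"
  shows "v = v'"
proof -
  have "vertex_of_label (vlabel v) = v" if "v \<in> V" for v
    using that by (cases rule: vertex_cases) simp_all
  with assms show ?thesis by metis
qed

lemma vlabel_sorted: "v \<in> V \<Longrightarrow> sorted_wrt lex_less (vlabel v)"
  by (cases v) (auto simp: V_def vlabel_def)

lemma vlabel_length: "length (vlabel v) = 3"
  by (cases v) (simp add: vlabel_def)

lemma elabel_length: "(v, w) \<in> E \<Longrightarrow> length (elabel v w) = 2"
  by (erule edge_label_cases) simp_all

lemma E_sub: "E \<subseteq> V \<times> V"
  by (auto simp: E_def V_def)

section \<open>Incidences, connectedness, directions and balancing of the piece\<close>

lemma E_out_left: "j \<le> m \<Longrightarrow> {w. ((j, 0), w) \<in> E} =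
    {(j, 1)} \<union> (if j = 0 then {(0, 2)} else {}) \<union> (if j < m then {(j + 1, 0)} else {})"
  by (auto simp: E_def)

lemma E_in_left: "j \<le> m \<Longrightarrow> {w. (w, (j, 0)) \<in> E} = (if j = 0 then {} else {(j - 1, 0)})"
  by (auto simp: E_def)

lemma E_out_right: "j \<le> m \<Longrightarrow> {w. ((j, 2 * j + 2), w) \<in> E} = (if j < m then {(j + 1, 2 * j + 4)} else {})"
  by (auto simp: E_def)

lemma E_in_right: "j \<le> m \<Longrightarrow> {w. (w, (j, 2 * j + 2)) \<in> E} =
    {(j, 2 * j + 1)} \<union> (if j = 0 then {(0, 0)} else {(j - 1, 2 * j)})"
  by (auto simp: E_def)

lemma E_out_odd: "k \<le> j \<Longrightarrow> j \<le> m \<Longrightarrow> {w. ((j, 2 * k + 1), w) \<in> E} =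
    {(j, 2 * k + 2)} \<union> (if j < m then {(j + 1, 2 * k + 2)} else {})"
  by (auto simp: E_def)

lemma E_in_odd: "k \<le> j \<Longrightarrow> j \<le> m \<Longrightarrow> {w. (w, (j, 2 * k + 1)) \<in> E} = {(j, 2 * k)}"
  by (auto simp: E_def; presburger)

lemma E_out_even: "1 \<le> k \<Longrightarrow> k \<le> j \<Longrightarrow> j \<le> m \<Longrightarrow> {w. ((j, 2 * k), w) \<in> E} = {(j, 2 * k + 1)}"
  by (auto simp: E_def)

lemma E_in_even: "1 \<le> k \<Longrightarrow> k \<le> j \<Longrightarrow> j \<le> m \<Longrightarrow>
    {w. (w, (j, 2 * k)) \<in> E} = {(j, 2 * k - 1), (j - 1, 2 * k - 1)}"
  by (auto simp: E_def; presburger)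

lemma connected_V:
  assumes "v \<in> V" shows "(lv, v) \<in> (E \<union> E\<inverse>)\<^sup>*"
proof -
  have sym: "sym ((E \<union> E\<inverse>)\<^sup>*)" by (intro sym_rtrancl sym_Un_converse)
  have floor: "((j, 0), (j, t)) \<in> (E \<union> E\<inverse>)\<^sup>*" if "j \<le> m" "t \<le> 2 * j + 2" for j t
    using that(2)
  proof (induction t)
    case (Suc t)
    then have "((j, t), (j, Suc t)) \<in> E \<union> E\<inverse>" using that(1) by (simp add: E_def)
    with Suc show ?case by (meson Suc_leD rtrancl.rtrancl_into_rtrancl)
  qed simp
  have side: "((0, 0), (j, 0)) \<in> (E \<union> E\<inverse>)\<^sup>*" if "j \<le> m" for j
    using that
  proof (induction j)
    case (Suc j)
    then have "((j, 0), (Suc j, 0)) \<in> E \<union> E\<inverse>" by (simp add: E_def)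
    with Suc show ?case by (meson Suc_leD rtrancl.rtrancl_into_rtrancl)
  qed simp
  obtain j t where v: "v = (j, t)" "j \<le> m" "t \<le> 2 * j + 2" using assms by (auto simp: V_def)
  have "(lv, (0, 0)) \<in> (E \<union> E\<inverse>)\<^sup>*" using side[of m] sym by (auto dest: symD)
  also have "((0, 0), (j, 0)) \<in> (E \<union> E\<inverse>)\<^sup>*" using side v by simp
  also have "((j, 0), v) \<in> (E \<union> E\<inverse>)\<^sup>*" using floor v by simp
  finally show ?thesis .
qed

lemma finite_V: "finite V"
proof (rule finite_subset)
  show "V \<subseteq> {..m} \<times> {..2 * m + 2}" by (auto simp: V_def)
qed simp

lemma dir_edge_V:
  assumes "(v, w) \<in> E"
  shows "coprime (dx v w) (dy v w) \<and> (\<exists>t::real. t > 0 \<and> of_int (px w - px v) = t * of_int (dx v w)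
        \<and> of_int (py w - py v) = t * of_int (dy v w))"
proof -
  have "coprime (dx v w) (dy v w) \<and> (\<exists>t>0. px w - px v = t * dx v w \<and> py w - py v = t * dy v w)"
    using assms
  proof (cases rule: edge_cases)
    case (first j)
    have "px w = - int j" "py w = 2 * (int m - int j) - (if j = m then (int m + 2) * (int m + 2) + 2 else 0)"
      using px_simps(3)[of j 0] py_simps(3)[of j 0] first by simp_all
    moreover have "dx v w = 1" "dy v w = (if j = m then - 1 else 0)"
      by (simp_all add: first dx_def dy_def slope_def)
    ultimately show ?thesis using first by (auto simp: algebra_simps intro!: add_pos_nonneg)
  next
    case (last j)
    have "dx v w = 1" "dy v w = (if j = m then 2 else 1)"
      by (simp_all add: last dx_def dy_def slope_def)
    then show ?thesis unfolding last px_simps py_simps by (auto simp: algebra_simps intro!: add_pos_nonneg)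
  next
    case (flat j k)
    have "dx v w = 1" "dy v w = 0"
      using flat by (auto simp: flat dx_def dy_def slope_def; presburger)+
    then show ?thesis unfolding flat(1,2) px_simps(3) py_simps(3) px_simps(4)[OF flat(3,4)] py_simps(4)[OF flat(3,4)]
      by auto
  next
    case (steep j k)
    have "px w = 2 * int k - int j + 1" "py w = 2 * (int m - int j) + int k + 1 - (if j = m then (int m + 2) * (int m + 2) + 2 else 0)"
      using px_simps(4)[of "k + 1" j] py_simps(4)[of "k + 1" j] steep by simp_all
    moreover have "dx v w = 1" "dy v w = 1"
      using steep(3,4) by (auto simp: steep(1,2) dx_def dy_def slope_def)
    ultimately show ?thesis unfolding steep(1) px_simps py_simps by auto
  next
    case top
    have "dx v w = 2" "dy v w = 1" by (simp_all add: top dx_def dy_def)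
    moreover have "px w - px v = 6 * 2" "py w - py v = 6"
      by (simp_all add: top px_def py_def)
    ultimately show ?thesis by (auto intro!: exI[of _ 6])
  next
    case (lside j)
    have "dx v w = - (int j + 3)" "dy v w = - 1" by (simp_all add: lside dx_def dy_def)
    moreover have "px w - px v = 2 * - (int j + 3)" "py w - py v = - 2"
      by (simp_all add: lside algebra_simps)
    ultimately show ?thesis by (auto intro!: exI[of _ 2])
  next
    case (rside j)
    have d: "dx v w = int j + 3" "dy v w = int j + 2" by (simp_all add: rside dx_def dy_def)
    have eq: "int j + 3 = int j + 2 + 1" by simp
    have "coprime (int j + 3) (int j + 2)" unfolding eq by (simp only: coprime_add_one_left)
    moreover have "px w = (int j + 3) * (int j + 4)" "py w = 2 * (int m - int j - 1) + (int j + 3) * (int j + 4)"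
      by (simp_all add: rside px_def py_def algebra_simps)
    then have "px w - px v = 2 * (int j + 3)" "py w - py v = 2 * (int j + 2)"
      unfolding rside(1) px_simps py_simps by (simp_all add: algebra_simps)
    ultimately show ?thesis unfolding d by (auto intro!: exI[of _ 2])
  next
    case (elev j k)
    have "k + 1 \<le> j + 1" using elev by simp
    have w: "px w = 2 * int k - int j" "py w = 2 * (int m - int j) + int k - 1 - (if j + 1 = m then (int m + 2) * (int m + 2) + 2 else 0)"
      using px_simps(4)[of "k + 1" "j + 1"] py_simps(4)[of "k + 1" "j + 1"] elev by (simp_all add: algebra_simps)
    have "2 * k + 1 \<noteq> 2 * j + 2" by presburger
    then have d: "dx v w = 0" "dy v w = - 1" by (simp_all add: elev dx_def dy_def)
    show ?thesis unfolding d w unfolding elev(1) px_simps py_simps using elev(4)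
      \<comment> \<open>A vertical edge has length 1, plus the full drop if it leads down to the
        last floor.\<close>
      by (auto intro!: exI[of _ "1 + (if j + 1 = m then (int m + 2) * (int m + 2) + 2 else 0)"] add_pos_nonneg)
  qed
  then obtain t where t: "coprime (dx v w) (dy v w)" "t > 0" "px w - px v = t * dx v w" "py w - py v = t * dy v w"
    by blast
  then show ?thesis
    by (intro conjI exI[of _ "of_int t"]) (simp_all flip: of_int_mult)
qed

lemma balanced_V:
  assumes "v \<in> V"
  shows "(\<Sum>w\<in>{w. (v, w) \<in> E}. dx v w) - (\<Sum>w\<in>{w. (w, v) \<in> E}. dx w v)
        + (if v = rv then int (m + 3) else 0) - (if v = lv then int (m + 3) else 0) = 0" (is ?x)
    and "(\<Sum>w\<in>{w. (v, w) \<in> E}. dy v w) - (\<Sum>w\<in>{w. (w, v) \<in> E}. dy w v)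
        - (if v \<in> F then int (wF v) else 0) + (if v = rv then int (m + 3) else 0) = 0" (is ?y)
proof -
  have "?x \<and> ?y"
    using assms
  proof (cases rule: vertex_cases)
    case (left j)
    have first: "dx (j, 0) (j, 1) = 1" "dy (j, 0) (j, 1) = (if j = m then - 1 else 0)"
      by (simp_all add: dx_def dy_def slope_def)
    have down: "dx (j, 0) (j + 1, 0) = - (int j + 3)" "dy (j, 0) (j + 1, 0) = - 1"
      by (simp_all add: dx_def dy_def)
    have up: "dx (j - 1, 0) (j, 0) = - (int j + 2)" "dy (j - 1, 0) (j, 0) = - 1" if "j \<noteq> 0"
      using that by (auto simp: dx_def dy_def of_nat_diff)
    have top: "dx (0, 0) (0, 2) = 2" "dy (0, 0) (0, 2) = 1" by (simp_all add: dx_def dy_def)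
    have "v \<notin> F" by (simp add: F_def left(1))
    then show ?thesis using left(2) first down up top
      unfolding left(1) E_out_left[OF left(2)] E_in_left[OF left(2)]
      by (cases "j = 0"; cases "j = m") simp_all
  next
    case (right j)
    have last: "dx (j, 2 * j + 1) (j, 2 * j + 2) = 1" "dy (j, 2 * j + 1) (j, 2 * j + 2) = (if j = m then 2 else 1)"
      by (simp_all add: dx_def dy_def slope_def)
    have down: "dx (j, 2 * j + 2) (j + 1, 2 * j + 4) = int j + 3" "dy (j, 2 * j + 2) (j + 1, 2 * j + 4) = int j + 2"
      by (simp_all add: dx_def dy_def)
    have up: "dx (j - 1, 2 * j) (j, 2 * j + 2) = int j + 2" "dy (j - 1, 2 * j) (j, 2 * j + 2) = int j + 1" if "j \<noteq> 0"
      using that by (auto simp: dx_def dy_def of_nat_diff)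
    have top: "dx (0, 0) (0, Suc (Suc 0)) = 2" "dy (0, 0) (0, Suc (Suc 0)) = 1" by (simp_all add: dx_def dy_def)
    have "v \<notin> F" by (simp add: F_def right(1))
    then show ?thesis using right(2) last down up top
      unfolding right(1) E_out_right[OF right(2)] E_in_right[OF right(2)]
      by (cases "j = 0"; cases "j = m") simp_all
  next
    case (odd j k)
    have ne: "2 * k + 1 \<noteq> 2 * j + 2" "2 * k \<noteq> 2 * k + 1" by presburger+
    have dn: "dx (j, 2 * k + 1) (j + 1, 2 * k + 2) = 0" "dy (j, 2 * k + 1) (j + 1, 2 * k + 2) = - 1"
      using ne by (simp_all add: dx_def dy_def)
    have out: "dx (j, 2 * k + 1) (j, 2 * k + 2) = 1" "dy (j, 2 * k + 1) (j, 2 * k + 2) = (if j = m \<and> k = m then 2 else 1)"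
      by (simp_all add: dx_def dy_def slope_def)
    have inn: "dx (j, 2 * k) (j, 2 * k + 1) = 1" "dy (j, 2 * k) (j, 2 * k + 1) = (if j = m \<and> k = 0 then - 1 else 0)"
      using odd by (simp_all add: dx_def dy_def slope_def)
    have F: "v \<in> F \<longleftrightarrow> j = m" using odd by (auto simp: F_def)
    have w: "int (wF v) = 1 + (if k = 0 then 1 else 0) + (if k = m then 1 else 0)"
      by (simp add: odd(1) wF_def)
    have "v \<noteq> lv" "v \<noteq> rv" using ne by (auto simp: odd(1))
    then show ?thesis using odd dn out inn F w
      unfolding odd(1) E_out_odd[OF odd(2,3)] E_in_odd[OF odd(2,3)]
      by (cases "j = m") simp_all
  next
    case (even j k)
    obtain h where h: "k = h + 1" using even(2) by (metis add.commute le_Suc_ex plus_1_eq_Suc)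
    then obtain g where g: "j = g + 1" using even(3) by (metis add.commute le_Suc_ex plus_1_eq_Suc even(2) le_trans)
    have ne: "2 * h + 1 \<noteq> 2 * g + 2" by presburger
    have out: "dx (j, 2 * k) (j, 2 * k + 1) = 1" "dy (j, 2 * k) (j, 2 * k + 1) = 0"
      using even(2,3) by (auto simp: dx_def dy_def slope_def; presburger)+
    have inn: "dx (j, 2 * k - 1) (j, 2 * k) = 1" "dy (j, 2 * k - 1) (j, 2 * k) = 1"
      using even(2,3) by (simp_all add: h dx_def dy_def slope_def)
    have up: "dx (j - 1, 2 * k - 1) (j, 2 * k) = 0" "dy (j - 1, 2 * k - 1) (j, 2 * k) = - 1"
      using ne by (simp_all add: h g dx_def dy_def)
    have "(j, 2 * k - 1) \<noteq> (j - 1, 2 * k - 1)" by (simp add: g)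
    moreover have "v \<notin> F" "v \<noteq> lv" "v \<noteq> rv" using even by (auto simp: F_def)
    ultimately show ?thesis using out inn up
      unfolding even(1) E_out_even[OF even(2-4)] E_in_even[OF even(2-4)]
      by simp
  qed
  then show ?x ?y by blast+
qed

section \<open>Counting vertices and edges\<close>

lemma card_V: "int (card V) = (int m + 1) * (int m + 3)"
proof -
  have "V = (SIGMA j:{..m}. {..2 * j + 2})" by (auto simp: V_def)
  then have "card V = (\<Sum>j\<le>m. 2 * j + 3)" by (auto intro!: sum.cong)
  moreover have "int (\<Sum>j\<le>m. 2 * j + 3) = (int m + 1) * (int m + 3)"
    by (induction m) (simp_all add: algebra_simps)
  ultimately show ?thesis by simp
qed

lemma card_E: "2 * int (card E) = 2 * (int m + 1) * (int m + 2) + 4 * int m + int m * (int m + 1) + 2"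
proof -
  define fl where "fl = (\<lambda>(j, t). ((j, t), (j, Suc t))) ` (SIGMA j:{..m}. {..<2 * j + 2})"
  define sl where "sl = (\<lambda>j. ((j, 0::nat), (Suc j, 0::nat))) ` {..<m}"
  define sr where "sr = (\<lambda>j. ((j, 2 * j + 2), (Suc j, 2 * j + 4))) ` {..<m}"
  define el where "el = (\<lambda>(j, k). ((j, 2 * k + 1), (Suc j, 2 * k + 2))) ` (SIGMA j:{..<m}. {..j})"
  have "E = fl \<union> sl \<union> sr \<union> el \<union> {((0, 0), (0, 2))}"
  proof (intro equalityI subsetI)
    fix e assume "e \<in> E"
    then have "(fst e, snd e) \<in> E" by simp
    then show "e \<in> fl \<union> sl \<union> sr \<union> el \<union> {((0, 0), (0, 2))}"
      by (cases rule: edge_cases; cases e) (force simp: fl_def sl_def sr_def el_def)+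
  next
    fix e assume "e \<in> fl \<union> sl \<union> sr \<union> el \<union> {((0, 0), (0, 2))}"
    then show "e \<in> E" by (auto simp: fl_def sl_def sr_def el_def E_def)
  qed
  moreover have fin: "finite fl" "finite sl" "finite sr" "finite el"
    by (simp_all add: fl_def sl_def sr_def el_def)
  moreover have "card (fl \<union> sl \<union> sr \<union> el \<union> {((0, 0), (0, 2))}) = card fl + card sl + card sr + card el + 1"
    using fin by (subst card_Un_disjoint; (auto simp: fl_def sl_def sr_def el_def; presburger)?)+
  moreover have "card fl = (\<Sum>j\<le>m. 2 * j + 2)"
    unfolding fl_def by (subst card_image) (auto simp: inj_on_def)
  moreover have "card sl = m" "card sr = m"
    unfolding sl_def sr_def by (subst card_image; auto simp: inj_on_def)+
  moreover have "card el = (\<Sum>j<m. j + 1)"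
    unfolding el_def by (subst card_image) (auto simp: inj_on_def)
  moreover have "int (\<Sum>j\<le>m. 2 * j + 2) = (int m + 1) * (int m + 2)"
    by (induction m) (simp_all add: algebra_simps)
  moreover have "2 * int (\<Sum>j<m. j + 1) = int m * (int m + 1)"
    by (induction m) (simp_all add: algebra_simps)
  ultimately show ?thesis by simp
qed

text \<open>With \<open>d = m + 3\<close> the genus is the number of interior lattice points of the
  triangle of size \<open>d\<close>.\<close>

lemma genus_V: "2 * (int (card E) - int (card V) + 1) = (int m + 2) * (int m + 1)"
  using card_E card_V by (simp add: algebra_simps)

section \<open>Embeddedness of the piece through its maximal terms\<close>

lemma dominant_edge:
  assumes "(v, w) \<in> E" "0 < t" "t < 1"
  shows "dominant c M ((1 - t) *\<^sub>R (of_int (px v), of_int (py v)) + t *\<^sub>R (of_int (px w), of_int (py w))) (set (elabel v w))"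
proof -
  have vw: "v \<in> V" "w \<in> V" using assms E_sub by auto
  have eq: "set (elabel v w) = set (vlabel v) \<inter> set (vlabel w)" by (auto simp: elabel_def)
  have "set (elabel v w) \<noteq> {}" using elabel_length[OF assms(1)] by auto
  then show ?thesis
    unfolding eq using dominant_segment[OF dominant_vertex[OF vw(1)] dominant_vertex[OF vw(2)]] assms by blast
qed

lemma dominant_down:
  assumes "v \<in> F" "t > 0"
  shows "dominant c M ((of_int (px v), of_int (py v)) - (0, t)) (set (tl (vlabel v)))"
proof -
  have v: "v \<in> V" using assms(1) by (auto simp: F_def V_def)
  obtain k where k: "v = (m, 2 * k + 1)" "k \<le> m"
    using assms(1) by (auto simp: F_def elim!: oddE)
  have "dominant c M ((of_int (px v), of_int (py v)) + t *\<^sub>R (0, - 1)) (set (tl (vlabel v)))"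
    \<comment> \<open>In direction (0, -1) a term grows at the rate of its row number, at most
      \<open>m + 3\<close>; only the first entry of the label, from row \<open>m + 2\<close>, is
      left behind.\<close>
    by (rule dominant_ray[OF dominant_vertex[OF v] assms(2), where \<sigma> = "real (m + 3)"])
      (use k in \<open>auto simp: M_def\<close>)
  then show ?thesis by simp
qed

lemma dominant_left:
  assumes "t > 0"
  shows "dominant c M (- of_int aa - t, 0) {(0, 0), (m + 3, 0)}"
proof -
  have "dominant c M ((of_int (px lv), of_int (py lv)) + t *\<^sub>R (- 1, 0)) {(0, 0), (m + 3, 0)}"
    \<comment> \<open>In direction (-1, 0) the growth rate is minus the exponent, so exactly the
      terms with exponent 0 survive.\<close>
    by (rule dominant_ray[OF dominant_vertex assms, where \<sigma> = 0]) (auto simp: V_def M_def)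
  then show ?thesis by simp
qed

lemma dominant_right:
  assumes "t > 0"
  shows "dominant c M (of_int aa + t, of_int aa + t) {(0, 0), (m + 3, m + 3)}"
proof -
  have "dominant c M ((of_int (px rv), of_int (py rv)) + t *\<^sub>R (1, 1)) {(0, 0), (m + 3, m + 3)}"
    by (rule dominant_ray[OF dominant_vertex assms, where \<sigma> = 0])
      (auto simp: V_def M_def simp del: mult_Suc_right)
  then show ?thesis unfolding px_simps py_simps by simp
qed

sublocale pc: piece V E F px py dx dy wF lv rv aa "m + 3"
proof unfold_locales
  show "px rv = aa" "py rv = aa" unfolding px_simps py_simps by simp_all
  show "coprime (dx v w) (dy v w)" if "(v, w) \<in> E" for v w using dir_edge_V[OF that] by blast
  show "\<exists>t::real. t > 0 \<and> of_int (px w - px v) = t * of_int (dx v w)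
        \<and> of_int (py w - py v) = t * of_int (dy v w)" if "(v, w) \<in> E" for v w using dir_edge_V[OF that] by blast
  show "(\<Sum>w\<in>{w. (v, w) \<in> E}. dx v w) - (\<Sum>w\<in>{w. (w, v) \<in> E}. dx w v)
        + (if v = rv then int (m + 3) else 0) - (if v = lv then int (m + 3) else 0) = 0" if "v \<in> V" for v
    by (rule balanced_V(1)[OF that])
  show "(\<Sum>w\<in>{w. (v, w) \<in> E}. dy v w) - (\<Sum>w\<in>{w. (w, v) \<in> E}. dy w v)
        - (if v \<in> F then int (wF v) else 0) + (if v = rv then int (m + 3) else 0) = 0" if "v \<in> V" for v
    by (rule balanced_V(2)[OF that])
  show "(lv, v) \<in> (E \<union> E\<inverse>)\<^sup>*" if "v \<in> V" for v by (rule connected_V[OF that])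
  show "F \<subseteq> V" by (auto simp: F_def V_def)
qed (simp_all add: finite_V E_sub wF_def, simp_all add: V_def)

fun clabel :: "(nat \<times> nat) cell \<Rightarrow> (nat \<times> nat) list" where
  "clabel (Vx v) = vlabel v"
| "clabel (Ed v w) = elabel v w"
| "clabel (Dn v) = tl (vlabel v)"
| "clabel LL = [(0, 0), (m + 3, 0)]"
| "clabel RR = [(0, 0), (m + 3, m + 3)]"

lemma cell_cases:
  assumes "\<kappa> \<in> pc.core \<union> {LL, RR}"
  obtains (vertex) v where "\<kappa> = Vx v" "v \<in> V" | (edge) v w where "\<kappa> = Ed v w" "(v, w) \<in> E"
    | (down) k where "\<kappa> = Dn (m, 2 * k + 1)" "k \<le> m" | (left) "\<kappa> = LL" | (right) "\<kappa> = RR"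
proof -
  have F: "thesis" if "\<kappa> = Dn v" "v \<in> F" for v
    using that down by (auto simp: F_def elim!: oddE)
  consider "\<kappa> \<in> Vx ` V" | "\<kappa> \<in> case_prod Ed ` E" | "\<kappa> \<in> Dn ` F" | "\<kappa> = LL" | "\<kappa> = RR"
    using assms unfolding pc.core_def by blast
  then show thesis by cases (use vertex edge F left right in auto)
qed

lemma dominant_cell:
  assumes "\<kappa> \<in> pc.core \<union> {LL, RR}" "p \<in> pc.pts \<kappa>"
  shows "dominant c M p (set (clabel \<kappa>))"
  using assms(1)
proof (cases rule: cell_cases)
  case (vertex v)
  then show ?thesis using assms(2) dominant_vertex[of v] by (simp add: pc.pt_def)
next
  case (edge v w)
  then show ?thesis using assms(2) dominant_edge[of v w] by (auto simp: pc.pt_def)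
next
  case (down k)
  then have "(m, 2 * k + 1) \<in> F" by (simp add: F_def)
  then show ?thesis using down assms(2) dominant_down[of "(m, 2 * k + 1)"]
    unfolding down clabel.simps pc.pts.simps pc.pt_def by blast
next
  case left
  then show ?thesis using assms(2) dominant_left by auto
next
  case right
  then show ?thesis using assms(2) dominant_right by auto
qed

lemma clabel_sorted:
  assumes "\<kappa> \<in> pc.core \<union> {LL, RR}"
  shows "sorted_wrt lex_less (clabel \<kappa>)"
  using assms
proof (cases rule: cell_cases)
  case (edge v w)
  then have "v \<in> V" using E_sub by auto
  then show ?thesis using edge vlabel_sorted by (simp add: elabel_def sorted_wrt_filter)
qed (auto simp: vlabel_sorted)

text \<open>Bounded edges never separate two terms of the bottom row, nor (0, 0) from another
  corner; those pairs belong to the unbounded rays.\<close>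

lemma elabel_not_fat:
  assumes "(v, w) \<in> E"
  shows "elabel v w \<noteq> [(m + 3, b), (m + 3, e)]" "elabel v w \<noteq> [(0, 0), (m + 3, 0)]"
    "elabel v w \<noteq> [(0, 0), (m + 3, m + 3)]"
  using assms by (cases rule: edge_label_cases; auto)+

lemma clabel_inj:
  assumes \<kappa>: "\<kappa> \<in> pc.core \<union> {LL, RR}" and \<kappa>': "\<kappa>' \<in> pc.core \<union> {LL, RR}"
    and eq: "clabel \<kappa> = clabel \<kappa>'"
  shows "\<kappa> = \<kappa>'"
proof -
  have len: "length (clabel \<kappa>) = 3 \<longleftrightarrow> (\<exists>v. \<kappa> = Vx v)" if "\<kappa> \<in> pc.core \<union> {LL, RR}" for \<kappa>
    using that by (cases rule: cell_cases) (simp_all add: vlabel_length elabel_length)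
  have down_label: "\<exists>b e. clabel (Dn (m, 2 * k + 1)) = [(m + 3, b), (m + 3, e)]" for k
    by simp
  have edge: "\<kappa>' = Ed v w" if E: "(v, w) \<in> E" and c: "\<kappa>' \<in> pc.core \<union> {LL, RR}" and l: "clabel \<kappa>' = elabel v w" for \<kappa>' v w
    using c
  proof (cases rule: cell_cases)
    case (vertex u)
    then show ?thesis using l vlabel_length[of u] elabel_length[OF E] by simp
  next
    case (edge v' w')
    then show ?thesis using l elabel_inj[OF E edge(2)] by simp
  next
    case (down k)
    then show ?thesis using l elabel_not_fat(1)[OF E] down_label[of k] by metis
  next
    case left
    then show ?thesis using l elabel_not_fat(2)[OF E] by simp
  next
    case right
    then show ?thesis using l elabel_not_fat(3)[OF E] by simp
  qed
  have flat: "\<kappa> = \<kappa>'" if "\<kappa> \<in> {LL, RR} \<union> Dn ` {(m, 2 * k + 1) | k. k \<le> m}"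
    "\<kappa>' \<in> {LL, RR} \<union> Dn ` {(m, 2 * k + 1) | k. k \<le> m}"
    using that eq by (auto split: if_splits)
  show ?thesis
  proof (cases "length (clabel \<kappa>) = 3")
    case True
    then obtain v v' where v: "\<kappa> = Vx v" "\<kappa>' = Vx v'" using len[OF \<kappa>] len[OF \<kappa>'] eq by metis
    then have "v \<in> V" "v' \<in> V" using \<kappa> \<kappa>' by (auto simp: pc.core_def)
    then show ?thesis using v eq vlabel_inj by simp
  next
    case False
    then have nv: "\<kappa> \<noteq> Vx v" "\<kappa>' \<noteq> Vx v" for v using len[OF \<kappa>] len[OF \<kappa>'] eq by metis+
    have thin: "\<kappa> \<in> {LL, RR} \<union> Dn ` {(m, 2 * k + 1) | k. k \<le> m} \<or> (\<exists>v w. \<kappa> = Ed v w \<and> (v, w) \<in> E)"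
      if "\<kappa> \<in> pc.core \<union> {LL, RR}" "\<And>v. \<kappa> \<noteq> Vx v" for \<kappa>
      using that by (cases rule: cell_cases) auto
    show ?thesis
    proof (cases "\<exists>v w. \<kappa> = Ed v w \<and> (v, w) \<in> E")
      case True
      then show ?thesis using edge[OF _ \<kappa>'] eq by auto
    next
      case False
      with thin[OF \<kappa> nv(1)] have \<kappa>_thin: "\<kappa> \<in> {LL, RR} \<union> Dn ` {(m, 2 * k + 1) | k. k \<le> m}" by (simp only: simp_thms)
      show ?thesis
      proof (cases "\<exists>v w. \<kappa>' = Ed v w \<and> (v, w) \<in> E")
        case True
        then show ?thesis using edge[OF _ \<kappa>] eq by auto
      next
        case False
        with thin[OF \<kappa>' nv(2)] show ?thesis using flat[OF \<kappa>_thin] by (simp only: simp_thms)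
      qed
    qed
  qed
qed

sublocale pc: embedded_piece V E F px py dx dy wF lv rv aa "m + 3"
proof unfold_locales
  fix \<kappa> \<kappa>'
  assume \<kappa>: "\<kappa> \<in> pc.core \<union> {LL, RR}" "\<kappa>' \<in> pc.core \<union> {LL, RR}" "\<kappa> \<noteq> \<kappa>'"
  show "pc.pts \<kappa> \<inter> pc.pts \<kappa>' = {}"
  proof (rule ccontr)
    assume "pc.pts \<kappa> \<inter> pc.pts \<kappa>' \<noteq> {}"
    then obtain p where "p \<in> pc.pts \<kappa>" "p \<in> pc.pts \<kappa>'" by blast
    then have "set (clabel \<kappa>) = set (clabel \<kappa>')"
      using dominant_unique dominant_cell \<kappa> by blast
    then have "clabel \<kappa> = clabel \<kappa>'" using lex_sorted_unique clabel_sorted \<kappa> by blast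
    then show False using clabel_inj \<kappa> by blast
  qed
qed

end

text \<open>For degree 1 and 2 the triangle has no interior lattice point; the piece is the vertex
  of the line itself, with three rays of weight \<open>d\<close>.\<close>

lemma embedded_star:
  assumes "d > 0"
  shows "embedded_piece {()} {} {()} (\<lambda>_. 0) (\<lambda>_. 0) (\<lambda>_ _. 0) (\<lambda>_ _. 0) (\<lambda>_. d) () () 0 d"
proof -
  interpret piece "{()}" "{}" "{()}" "\<lambda>_. 0" "\<lambda>_. 0" "\<lambda>_ _. 0" "\<lambda>_ _. 0" "\<lambda>_. d" "()" "()" 0 d
    by unfold_locales (use assms in auto)
  show ?thesis
    by unfold_locales (auto simp: core_def pt_def)
qed

theorem theorem1p1:
  fixes d :: nat
  assumes "d \<ge> 1" and "CARD('n::finite) \<ge> 2"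
  shows "\<exists>C :: 'n tcurve. tropical_curve C \<and> planar C \<and> degree C = int d \<and>
           genus C = (int CARD('n) - 1) * (((int d - 1) * (int d - 2)) div 2)"
proof -
  obtain h where "bij_betw h {1..CARD('n)} (UNIV :: 'n set)"
    using ex_bij_betw_nat_finite_1[of "UNIV :: 'n set"] by auto
  then obtain idx :: "'n \<Rightarrow> nat" where "bij_betw idx UNIV {1..CARD('n)}"
    using bij_betw_inv_into by blast
  then interpret ground_order idx "CARD('n)" by unfold_locales
  show ?thesis
  proof (cases "d \<le> 2")
    case True
    interpret embedded_piece "{()}" "{}" "{()}" "\<lambda>_. 0" "\<lambda>_. 0" "\<lambda>_ _. 0" "\<lambda>_ _. 0" "\<lambda>_. d" "()" "()" 0 d
      by (rule embedded_star) (use assms in simp)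
    interpret chain "{()}" "{}" "{()}" "\<lambda>_. 0" "\<lambda>_. 0" "\<lambda>_ _. 0" "\<lambda>_ _. 0" "\<lambda>_. d" "()" "()" 0 d idx "CARD('n)"
      by unfold_locales (rule assms(2))
    have "d = 1 \<or> d = 2" using True assms(1) by linarith
    then show ?thesis using ex_planar_curve by auto
  next
    case False
    then obtain m where d: "d = m + 3" by (metis add.commute le_Suc_ex not_less_eq_eq numeral_2_eq_2 numeral_3_eq_3)
    interpret floors m .
    interpret chain V E F px py dx dy wF lv rv aa "m + 3" idx "CARD('n)"
      by unfold_locales (rule assms(2))
    have "int (card E) - int (card V) + 1 = ((int d - 1) * (int d - 2)) div 2"
      using genus_V by (simp add: d algebra_simps)
    then show ?thesis using ex_planar_curve by (simp add: d)
  qed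
qed

end
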